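(* Let the exponential family $(P_\tau)_{\tau\in J}$, the response process and the adaptive $p$-step-ahead algorithm be as described in the context, with true parameter point $\overline\theta\in\Theta$, arbitrary adaptive estimators $\widehat\theta_k$ employed by the algorithm, and adaptive maximum likelihood estimators $\widehat\theta_k^{(\mathrm{ML})}$. Assume the following. (GLM$^*$) $\Theta\subseteq\mathbb R^p$ (with the Euclidean metric); $G:I\to\mathbb R$ is a continuously differentiable function on an open interval $I\subseteq\mathbb R$ with $G'>0$ and $G(I)\subseteq b'(J)$; $f:\mathcal X\to\mathbb R^p$ is continuous with $f^{T}(x)\theta\in I$ for all $(x,\theta)\in\mathcal X\times\Theta$; and for all $(x,\theta)\in\mathcal X\times\Theta$ $$\mu(x,\theta)=G\bigl(f^{T}(x)\theta\bigr),\qquad f_\theta(x)=\varphi\bigl(f^{T}(x)\theta\bigr)f(x),\qquad\text{where } \varphi(u)=\frac{G'(u)}{\sqrt{b''\bigl((b')^{-1}(G(u))\bigr)}},\ u\in I,$$ with $\psi(x,\theta)=\varphi(f^{T}(x)\theta)$ a continuous function $\mathcal X\times\Theta\to(0,\infty)$. (a1) There is a nondecreasing sequence $\mathcal F_0\subseteq\mathcal F_1\subseteq\cdots$ of sub-sigma-fields of $\mathcal F$ such that for each $k\in\mathbb N$ the random vector $\boldsymbol X_k=(X_{n_{k-1}+1},\ldots,X_{n_k})$ is $\mathcal F_{k-1}$-measurable and $\boldsymbol Y_k=(Y_{n_{k-1}+1},\ldots,Y_{n_k})^{T}$ is $\mathcal F_k$-measurable. (a2') For each $k\in\mathbb N$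 the conditional distribution of $\boldsymbol Y_k$ given $\mathcal F_{k-1}$ is the product of the distributions $P_{\overline\tau_i}$, $n_{k-1}+1\le i\le n_k$, where $\overline\tau_i=(b')^{-1}\bigl(G(f^{T}(X_i)\overline\theta)\bigr)$. Then $\widehat\theta_k^{(\mathrm{ML})}\to\overline\theta$ almost surely as $k\to\infty$.
   Context: Setting: $p\in\mathbb N$; $\mathcal X$ (experimental region) and $\Theta$ (parameter space) are compact metric spaces; $\mu:\mathcal X\times\Theta\to\mathbb R$ is continuous; $f_\theta:\mathcal X\to\mathbb R^p$, $\theta\in\Theta$, is a family of functions such that $(x,\theta)\mapsto f_\theta(x)$ is continuous on $\mathcal X\times\Theta$ and, for each $\theta\in\Theta$, the image $f_\theta(\mathcal X)$ spans $\mathbb R^p$. Vectors are column vectors. Exponential family: $J\subseteq\mathbb R$ is an open interval and $P_\tau$, $\tau\in J$, are probability distributions on the Borel sigma-field of $\mathbb R$ with densities with respect to some Borel measure $\nu$ of the form $p_\tau(y)=K(y)\exp(\tau y-b(\tau))$, $y\in\mathbb R$, where $K$ is a nonnegative measurable function and $b:J\to\mathbb R$. The function $b$ is infinitely differentiable, $b'(\tau)$ is the expectation and $b''(\tau)>0$ is the variance of $P_\tau$ (so the family is non-degenerate); hence $b'$ is a bijection from $J$ onto the open interval $b'(J)$, with inverse $(b')^{-1}$. Process and algorithm: $X_i$ and $Y_i$, $i\in\mathbb N$, are random variables on a probability space $(\Omega,\mathcal F,\mathbb P_{\overline\theta})$ with values in $\mathcal X$ and $\mathbb R$, respectively, where $\overline\theta\in\Theta$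 is the true parameter point. Let $n_1\in\mathbb N$, $n_0:=0$, and $n_k:=n_1+(k-1)p$ for $k\ge1$. The adaptive estimators employed by the algorithm are arbitrary $\Theta$-valued estimators $\widehat\theta_k=\widehat\theta_k(X_1,Y_1,\ldots,X_{n_k},Y_{n_k})$, $k\ge1$. The points $X_1,\ldots,X_{n_1}$ are arbitrary initial design points, and the $p$-step-ahead algorithm chooses the subsequent points so that for every $k\ge1$ (pathwise) $$\bigl(\det[f_{\widehat\theta_k}(X_{n_k+1}),\ldots,f_{\widehat\theta_k}(X_{n_k+p})]\bigr)^2=\max_{z_1,\ldots,z_p\in\mathcal X}\bigl(\det[f_{\widehat\theta_k}(z_1),\ldots,f_{\widehat\theta_k}(z_p)]\bigr)^2 .$$ The adaptive maximum likelihood estimator $\widehat\theta_k^{(\mathrm{ML})}=\widehat\theta_k^{(\mathrm{ML})}(X_1,Y_1,\ldots,X_{n_k},Y_{n_k})$ is a $\Theta$-valued random variable maximizing over $\theta\in\Theta$ the log-likelihood $$L_{n_k}(\theta)=\sum_{i=1}^{n_k}\bigl(\log K(Y_i)+\tau_i(\theta)Y_i-b(\tau_i(\theta))\bigr),\qquad \tau_i(\theta)=(b')^{-1}\bigl(G(f^{T}(X_i)\theta)\bigr).$$ It need not coincide with $\widehat\theta_k$. *)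

theory Defs
  imports "HOL-Probability.Probability"
begin

text \<open>That \<open>b\<close> is smooth and that \<open>b'\<close>, \<open>b''\<close> are mean and variance already follows from the form of
  the densities and \<open>J\<close> being open; \<open>variance_pos\<close> is non-degeneracy.\<close>

locale exponential_family =
  fixes J :: "real set" and P :: "real \<Rightarrow> real measure" and \<nu> :: "real measure"
    and K b :: "real \<Rightarrow> real"
  assumes J_open: "open J" and J_interval: "is_interval J"
    and sets_nu: "sets \<nu> = sets borel"
    and K_measurable: "K \<in> borel_measurable borel"
    and K_nonneg: "\<And>y. 0 \<le> K y"
    and P_prob: "\<And>\<tau>. \<tau> \<in> J \<Longrightarrow> prob_space (P \<tau>)"
    and P_density: "\<And>\<tau>. \<tau> \<in> J \<Longrightarrow> P \<tau> = density \<nu> (\<lambda>y. ennreal (K y * exp (\<tau> * y - b \<tau>)))"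
    and b_smooth: "\<And>m \<tau>. \<tau> \<in> J \<Longrightarrow> (deriv ^^ m) b differentiable (at \<tau>)"
    and P_moments: "\<And>\<tau>. \<tau> \<in> J \<Longrightarrow> integrable (P \<tau>) (\<lambda>y. y) \<and> integrable (P \<tau>) (\<lambda>y. y\<^sup>2)"
    and P_mean: "\<And>\<tau>. \<tau> \<in> J \<Longrightarrow> (\<integral>y. y \<partial>P \<tau>) = deriv b \<tau>"
    and P_variance: "\<And>\<tau>. \<tau> \<in> J \<Longrightarrow> (\<integral>y. (y - deriv b \<tau>)\<^sup>2 \<partial>P \<tau>) = deriv (deriv b) \<tau>"
    and variance_pos: "\<And>\<tau>. \<tau> \<in> J \<Longrightarrow> 0 < deriv (deriv b) \<tau>"

text \<open>The inverse \<open>(b')\<^sup>-\<^sup>1\<close> of \<open>b' : J \<rightarrow> b'(J)\<close>; its values outside \<open>b'(J)\<close> are unspecified.\<close>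

definition mean_inv :: "real set \<Rightarrow> (real \<Rightarrow> real) \<Rightarrow> real \<Rightarrow> real" where
  "mean_inv J b = the_inv_into J (deriv b)"

definition glm_phi :: "real set \<Rightarrow> (real \<Rightarrow> real) \<Rightarrow> (real \<Rightarrow> real) \<Rightarrow> real \<Rightarrow> real" where
  "glm_phi J b G u = deriv G u / sqrt (deriv (deriv b) (mean_inv J b (G u)))"

definition glm_tau ::
  "real set \<Rightarrow> (real \<Rightarrow> real) \<Rightarrow> (real \<Rightarrow> real) \<Rightarrow> ('x \<Rightarrow> real ^ 'p) \<Rightarrow> 'x \<Rightarrow> real ^ 'p \<Rightarrow> real" where
  "glm_tau J b G f x \<theta> = mean_inv J b (G (f x \<bullet> \<theta>))"

text \<open>Logarithm on \<open>[0,\<infinity>)\<close> with \<open>log 0 = -\<infinity>\<close>: \<open>K\<close> may vanish, whereas the library's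
  \<^term>\<open>ln (0::real)\<close> is \<open>0\<close>.\<close>

definition ext_ln :: "real \<Rightarrow> ereal" where
  "ext_ln t = (if t = 0 then - \<infinity> else ereal (ln t))"

definition log_lik ::
  "real set \<Rightarrow> (real \<Rightarrow> real) \<Rightarrow> (real \<Rightarrow> real) \<Rightarrow> (real \<Rightarrow> real) \<Rightarrow> ('x \<Rightarrow> real ^ 'p)
    \<Rightarrow> nat \<Rightarrow> (nat \<Rightarrow> 'x) \<Rightarrow> (nat \<Rightarrow> real) \<Rightarrow> real ^ 'p \<Rightarrow> ereal" where
  "log_lik J K b G f n x y \<theta> =
    (\<Sum>i=1..n. ext_ln (K (y i))
      + ereal (glm_tau J b G f (x i) \<theta> * y i - b (glm_tau J b G f (x i) \<theta>)))"

definition stage_end :: "nat \<Rightarrow> nat \<Rightarrow> nat \<Rightarrow> nat" where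
  "stage_end p n1 k = (if k = 0 then 0 else n1 + (k - 1) * p)"

definition stage :: "nat \<Rightarrow> nat \<Rightarrow> nat \<Rightarrow> nat set" where
  "stage p n1 k = {stage_end p n1 (k - 1) + 1 .. stage_end p n1 k}"

definition history :: "nat \<Rightarrow> (nat \<Rightarrow> 'w \<Rightarrow> 'x) \<Rightarrow> (nat \<Rightarrow> 'w \<Rightarrow> real) \<Rightarrow> 'w \<Rightarrow> nat \<Rightarrow> 'x \<times> real" where
  "history n X Y \<omega> = (\<lambda>i\<in>{1..n}. (X i \<omega>, Y i \<omega>))"

text \<open>A statistic \<open>t(x\<^sub>1,y\<^sub>1,\<dots>,x\<^sub>n,y\<^sub>n)\<close> with values in \<open>\<Theta>\<close>: a measurable map
  \<open>(\<X> \<times> \<real>)\<^sup>n \<rightarrow> \<Theta>\<close>.\<close>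

definition estimators ::
  "'x::topological_space set \<Rightarrow> 'a::topological_space set \<Rightarrow> nat \<Rightarrow> ((nat \<Rightarrow> 'x \<times> real) \<Rightarrow> 'a) set" where
  "estimators \<X> \<Theta> n =
    (\<Pi>\<^sub>M i\<in>{1..n}. restrict_space borel \<X> \<Otimes>\<^sub>M borel) \<rightarrow>\<^sub>M restrict_space borel \<Theta>"

text \<open>The determinant \<open>det [v\<^sub>1, \<dots>, v\<^sub>p]\<close> of the matrix with columns \<open>v\<^sub>1, \<dots>, v\<^sub>p\<close>.
  Since \<open>'p\<close> carries no order, \<open>to_nat_on UNIV\<close>, a bijection from \<open>'p\<close> to \<open>{0..<p}\<close>,
  numbers the columns; only the square of this determinant is used below, and it does not depend on
  the numbering.\<close>

definition det_cols :: "(nat \<Rightarrow> real ^ 'p) \<Rightarrow> real" where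
  "det_cols v = det (\<chi> i j. v (to_nat_on (UNIV :: 'p set) j + 1) $ i)"

definition det_maximizing :: "'x set \<Rightarrow> ('x \<Rightarrow> real ^ 'p) \<Rightarrow> (nat \<Rightarrow> 'x) \<Rightarrow> bool" where
  "det_maximizing \<X> g x \<longleftrightarrow>
    x \<in> {1..CARD('p)} \<rightarrow> \<X> \<and>
    (\<forall>z \<in> {1..CARD('p)} \<rightarrow> \<X>. (det_cols (\<lambda>j. g (z j)))\<^sup>2 \<le> (det_cols (\<lambda>j. g (x j)))\<^sup>2)"

text \<open>The kernel \<open>\<kappa>\<close> is a (regular) conditional distribution, given the sub-sigma-field \<open>F\<close> of
  \<open>M\<close>, of the random variable \<open>Y\<close> with values in \<open>N\<close>.\<close>

definition is_cond_distr ::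
  "'w measure \<Rightarrow> 'w measure \<Rightarrow> 'b measure \<Rightarrow> ('w \<Rightarrow> 'b) \<Rightarrow> ('w \<Rightarrow> 'b measure) \<Rightarrow> bool" where
  "is_cond_distr M F N Y \<kappa> \<longleftrightarrow>
    \<kappa> \<in> F \<rightarrow>\<^sub>M prob_algebra N \<and>
    (\<forall>B\<in>sets N. AE \<omega> in M. real_cond_exp M F (\<lambda>\<omega>. indicator B (Y \<omega>)) \<omega> = measure (\<kappa> \<omega>) B)"

end

theory Submission
  imports Defs "HOL-Library.Discrete_Functions"
begin

text \<open>
  Why the theorem holds. Write \<open>\<tau>(x,\<theta>) = (b')\<^sup>-\<^sup>1(G(f(x)\<^sup>T\<theta>))\<close> for the natural parameter,
  \<open>\<theta>0\<close> for the true parameter point and \<open>e\<^sub>i = Y\<^sub>i - b'(\<tau>(X\<^sub>i,\<theta>0))\<close> for the residuals. Almost surely no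
  \<open>K(Y\<^sub>i)\<close> vanishes, so the terms \<open>log K(Y\<^sub>i)\<close> are finite and drop out of the log-likelihood ratio, which becomes
  \<open>\<Sum>(\<tau>(X\<^sub>i,\<theta>) - \<tau>(X\<^sub>i,\<theta>0)) e\<^sub>i - \<Sum>B\<^sub>i(\<theta>)\<close> with
  \<open>B\<^sub>i(\<theta>) = b(\<tau>(X\<^sub>i,\<theta>)) - b(\<tau>(X\<^sub>i,\<theta>0)) - b'(\<tau>(X\<^sub>i,\<theta>0)) (\<tau>(X\<^sub>i,\<theta>) - \<tau>(X\<^sub>i,\<theta>0))\<close>.

  The second sum grows linearly away from \<open>\<theta>0\<close>. By compactness all natural parameters lie in a compact
  interval on which \<open>b\<close> is strongly convex (\<open>b_strongly_convex\<close>) and \<open>(b')\<^sup>-\<^sup>1 \<circ> G\<close> is bi-Lipschitz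
  (\<open>natural_parameter_bilipschitz\<close>), so \<open>B\<^sub>i(\<theta>)\<close> dominates a multiple of \<open>(f(X\<^sub>i)\<^sup>T(\<theta> - \<theta>0))\<^sup>2\<close>. Each
  stage chosen by the algorithm maximizes a determinant, and since \<open>f\<^sub>\<theta>\<close> is \<open>f\<close> times a factor bounded
  away from \<open>0\<close> and \<open>\<infinity>\<close>, the sum of these squares over one stage is at least a fixed multiple of
  \<open>norm (\<theta> - \<theta>0)\<^sup>2\<close>, whatever the estimator employed (\<open>det_maximizing_information\<close>).

  The first sum is \<open>o(k)\<close> after \<open>k\<close> stages, uniformly in \<open>\<theta>\<close>. For fixed \<open>\<theta>\<close> the stage sums are martingale
  differences with bounded variances, to which an elementary strong law applies
  (\<open>SLLN_martingale_differences\<close>, \<open>residual_law_of_large_numbers\<close>). Uniformity follows from the Lipschitz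
  continuity of \<open>\<tau>\<close> in \<open>\<theta>\<close>, the compactness of \<open>\<Theta>\<close>, and the linear growth of \<open>\<Sum>\<bar>e\<^sub>i\<bar>\<close>, which is the same strong law
  for \<open>\<bar>Y\<^sub>i\<bar>\<close> (\<open>abs_residuals_bounded\<close>). As the log-likelihood ratio at the maximizer is nonnegative, the
  maximizer must converge to \<open>\<theta>0\<close> (\<open>argmax_consistency\<close>).
\<close>

section \<open>A strong law of large numbers for orthogonal random variables\<close>

lemma integrable_mult_of_squares:
  fixes f g :: "'a \<Rightarrow> real"
  assumes "f \<in> borel_measurable M" "g \<in> borel_measurable M"
    and "integrable M (\<lambda>x. (f x)\<^sup>2)" "integrable M (\<lambda>x. (g x)\<^sup>2)"
  shows "integrable M (\<lambda>x. f x * g x)"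
proof (rule Bochner_Integration.integrable_bound)
  show "integrable M (\<lambda>x. (f x)\<^sup>2 + (g x)\<^sup>2)"
    using assms by simp
  have "\<bar>a * c\<bar> \<le> a\<^sup>2 + c\<^sup>2" for a c :: real
    using sum_squares_bound[of "\<bar>a\<bar>" "\<bar>c\<bar>"] mult_nonneg_nonneg[of "\<bar>a\<bar>" "\<bar>c\<bar>"]
    unfolding abs_mult power2_abs by linarith
  then show "AE x in M. norm (f x * g x) \<le> norm ((f x)\<^sup>2 + (g x)\<^sup>2)"
    by (auto simp del: abs_mult)
qed (use assms in measurable)

lemma (in prob_space) second_moment_sum_orthogonal:
  fixes Z :: "nat \<Rightarrow> 'a \<Rightarrow> real"
  assumes meas [measurable]: "\<And>j. Z j \<in> borel_measurable M"
    and int2: "\<And>j. integrable M (\<lambda>\<omega>. (Z j \<omega>)\<^sup>2)"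
    and orth: "\<And>i j. i < j \<Longrightarrow> expectation (\<lambda>\<omega>. Z i \<omega> * Z j \<omega>) = 0"
    and bound: "\<And>j. expectation (\<lambda>\<omega>. (Z j \<omega>)\<^sup>2) \<le> C"
    and "finite A"
  shows "integrable M (\<lambda>\<omega>. (\<Sum>j\<in>A. Z j \<omega>)\<^sup>2)"
    and "expectation (\<lambda>\<omega>. (\<Sum>j\<in>A. Z j \<omega>)\<^sup>2) \<le> C * card A"
proof -
  have int: "integrable M (\<lambda>\<omega>. Z i \<omega> * Z j \<omega>)" for i j
    using integrable_mult_of_squares[OF meas meas int2 int2] .
  have sq: "(\<Sum>j\<in>A. Z j \<omega>)\<^sup>2 = (\<Sum>i\<in>A. \<Sum>j\<in>A. Z i \<omega> * Z j \<omega>)" for \<omega>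
    by (simp add: power2_eq_square sum_product)
  show "integrable M (\<lambda>\<omega>. (\<Sum>j\<in>A. Z j \<omega>)\<^sup>2)"
    unfolding sq using int by auto
  have 0: "expectation (\<lambda>\<omega>. Z i \<omega> * Z j \<omega>) = 0" if "i \<noteq> j" for i j
    using orth[of i j] orth[of j i] that by (cases i j rule: linorder_cases) (auto simp: mult.commute)
  have "expectation (\<lambda>\<omega>. (\<Sum>j\<in>A. Z j \<omega>)\<^sup>2) = (\<Sum>i\<in>A. \<Sum>j\<in>A. expectation (\<lambda>\<omega>. Z i \<omega> * Z j \<omega>))"
    unfolding sq using int by (simp add: Bochner_Integration.integral_sum)
  also have "\<dots> = (\<Sum>i\<in>A. expectation (\<lambda>\<omega>. Z i \<omega> * Z i \<omega>))"
  proof (rule sum.cong[OF refl])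
    fix i assume "i \<in> A"
    have "(\<Sum>j\<in>A. expectation (\<lambda>\<omega>. Z i \<omega> * Z j \<omega>))
        = (\<Sum>j\<in>A. if j = i then expectation (\<lambda>\<omega>. Z i \<omega> * Z i \<omega>) else 0)"
      by (rule sum.cong) (auto simp: 0)
    then show "(\<Sum>j\<in>A. expectation (\<lambda>\<omega>. Z i \<omega> * Z j \<omega>)) = expectation (\<lambda>\<omega>. Z i \<omega> * Z i \<omega>)"
      using \<open>finite A\<close> \<open>i \<in> A\<close> by simp
  qed
  also have "\<dots> \<le> (\<Sum>i\<in>A. C)"
    using bound by (intro sum_mono) (simp add: power2_eq_square)
  finally show "expectation (\<lambda>\<omega>. (\<Sum>j\<in>A. Z j \<omega>)\<^sup>2) \<le> C * card A"
    by (simp add: mult.commute)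
qed

text \<open>Strong law for an orthogonal sequence with bounded second moments. Let \<open>S m\<close> be the sum of the first
  \<open>m\<close> terms. As \<open>E (S m)\<^sup>2 = O(m)\<close>, the expectations of \<open>(S m / m)\<^sup>2\<close> along the squares
  \<open>m = k\<^sup>2\<close> are summable. Between \<open>k\<^sup>2\<close> and \<open>(k+1)\<^sup>2\<close> there are only \<open>2k + 1\<close>
  indices, so that even the sum of \<open>(S m - S (k\<^sup>2))\<^sup>2\<close> over this gap has expectation \<open>O(k\<^sup>2)\<close>,
  and no maximal inequality is needed.\<close>

theorem (in prob_space) SLLN_orthogonal:
  fixes Z :: "nat \<Rightarrow> 'a \<Rightarrow> real"
  assumes meas [measurable]: "\<And>j. Z j \<in> borel_measurable M"
    and int2: "\<And>j. integrable M (\<lambda>\<omega>. (Z j \<omega>)\<^sup>2)"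
    and orth: "\<And>i j. i < j \<Longrightarrow> expectation (\<lambda>\<omega>. Z i \<omega> * Z j \<omega>) = 0"
    and bound: "\<And>j. expectation (\<lambda>\<omega>. (Z j \<omega>)\<^sup>2) \<le> C"
  shows "AE \<omega> in M. (\<lambda>m. (\<Sum>j<m. Z j \<omega>) / real m) \<longlonglongrightarrow> 0"
proof -
  have mom: "integrable M (\<lambda>\<omega>. (\<Sum>j\<in>A. Z j \<omega>)\<^sup>2)"
      "expectation (\<lambda>\<omega>. (\<Sum>j\<in>A. Z j \<omega>)\<^sup>2) \<le> C * card A" if "finite A" for A
    using second_moment_sum_orthogonal[where Z=Z, OF meas int2 orth bound that] by auto
  have C0: "0 \<le> C"
    by (rule order_trans[OF _ bound[of 0]]) simp
  \<comment> \<open>\<open>A k\<close> bounds \<open>(S m / m)\<^sup>2 / 2\<close> for all \<open>m\<close> with \<open>k = \<lfloor>sqrt m\<rfloor>\<close>, and \<open>E (A k) = O(1/k\<^sup>2)\<close> is summable.\<close>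
  define A where "A k \<omega> = ((\<Sum>j<k\<^sup>2. Z j \<omega>)\<^sup>2
      + (\<Sum>m\<in>{k\<^sup>2..<(Suc k)\<^sup>2}. (\<Sum>j\<in>{k\<^sup>2..<m}. Z j \<omega>)\<^sup>2)) / real k ^ 4" for k \<omega>
  have A_meas [measurable]: "A k \<in> borel_measurable M" for k
    unfolding A_def by measurable
  have A_nonneg: "0 \<le> A k \<omega>" for k \<omega>
    unfolding A_def by (intro divide_nonneg_nonneg add_nonneg_nonneg sum_nonneg) auto
  have A_int: "integrable M (A k)" for k
    unfolding A_def using mom(1) by (intro integrable_divide Bochner_Integration.integrable_add
        Bochner_Integration.integrable_sum) auto
  have A_le: "expectation (A k) \<le> 10 * C * inverse (real k ^ 2)" for k
  proof (cases "k = 0")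
    case True
    then have "A k = (\<lambda>_. 0)" by (simp add: A_def fun_eq_iff)
    then show ?thesis using C0 by simp
  next
    case False
    have 2: "expectation (\<lambda>\<omega>. (\<Sum>j\<in>{k\<^sup>2..<m}. Z j \<omega>)\<^sup>2) \<le> C * (2 * real k + 1)"
      if "m \<in> {k\<^sup>2..<(Suc k)\<^sup>2}" for m
    proof -
      have "m - k\<^sup>2 \<le> 2 * k + 1" using that by (auto simp: power2_eq_square)
      then have "real (m - k\<^sup>2) \<le> 2 * real k + 1" by linarith
      then show ?thesis
        using mom(2)[of "{k\<^sup>2..<m}"] mult_left_mono[OF _ C0, of "real (m - k\<^sup>2)" "2 * real k + 1"]
        by simp
    qed
    have "expectation (A k) = (expectation (\<lambda>\<omega>. (\<Sum>j<k\<^sup>2. Z j \<omega>)\<^sup>2)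
      + (\<Sum>m\<in>{k\<^sup>2..<(Suc k)\<^sup>2}. expectation (\<lambda>\<omega>. (\<Sum>j\<in>{k\<^sup>2..<m}. Z j \<omega>)\<^sup>2))) / real k ^ 4"
      unfolding A_def using mom(1) by (simp add: Bochner_Integration.integral_sum)
    also have "\<dots> \<le> (C * real (k\<^sup>2) + (\<Sum>m\<in>{k\<^sup>2..<(Suc k)\<^sup>2}. C * (2 * real k + 1))) / real k ^ 4"
      using 2 mom(2)[of "{..<k\<^sup>2}"] by (intro divide_right_mono add_mono sum_mono) auto
    also have "(\<Sum>m\<in>{k\<^sup>2..<(Suc k)\<^sup>2}. C * (2 * real k + 1)) = C * (2 * real k + 1)\<^sup>2"
      by (simp add: power2_eq_square algebra_simps)
    also have "(C * real (k\<^sup>2) + C * (2 * real k + 1)\<^sup>2) / real k ^ 4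
        \<le> (10 * C * real (k\<^sup>2)) / real k ^ 4"
    proof (rule divide_right_mono)
      have "real k \<ge> 1" using False by simp
      then have "(2 * real k + 1)\<^sup>2 \<le> (3 * real k)\<^sup>2"
        by (intro power_mono) auto
      then have "C * (2 * real k + 1)\<^sup>2 \<le> C * (3 * real k)\<^sup>2"
        using C0 by (rule mult_left_mono)
      then show "C * real (k\<^sup>2) + C * (2 * real k + 1)\<^sup>2 \<le> 10 * C * real (k\<^sup>2)"
        by (simp add: power_mult_distrib)
    qed simp
    also have "\<dots> = 10 * C * inverse (real k ^ 2)"
      using False by (simp add: field_simps power2_eq_square power4_eq_xxxx)
    finally show ?thesis .
  qed
  have summ: "summable (\<lambda>k. 10 * C * inverse (real k ^ 2))"
    using inverse_power_summable[of 2, where 'a=real] by (intro summable_mult) simp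
  have "(\<integral>\<^sup>+\<omega>. (\<Sum>k. ennreal (A k \<omega>)) \<partial>M) = (\<Sum>k. \<integral>\<^sup>+\<omega>. ennreal (A k \<omega>) \<partial>M)"
    by (rule nn_integral_suminf) measurable
  also have "\<dots> \<le> (\<Sum>k. ennreal (10 * C * inverse (real k ^ 2)))"
  proof (rule suminf_le)
    show "(\<integral>\<^sup>+\<omega>. ennreal (A k \<omega>) \<partial>M) \<le> ennreal (10 * C * inverse (real k ^ 2))" for k
      using A_le[of k] nn_integral_eq_integral[OF A_int[of k]] A_nonneg
      by (simp add: ennreal_leI)
  qed (rule summableI)+
  also have "\<dots> < \<infinity>"
    unfolding infinity_ennreal_def less_top[symmetric]
    by (rule ennreal_suminf_neq_top[OF summ]) (use C0 in simp)
  finally have "AE \<omega> in M. (\<Sum>k. ennreal (A k \<omega>)) \<noteq> \<infinity>"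
    by (intro nn_integral_PInf_AE) auto
  then show ?thesis
  proof (eventually_elim)
    case (elim \<omega>)
    have "summable (\<lambda>k. A k \<omega>)"
      using elim A_nonneg by (intro summable_suminf_not_top) auto
    then have lim: "(\<lambda>k. A k \<omega>) \<longlonglongrightarrow> 0"
      by (rule summable_LIMSEQ_zero)
    have "filterlim floor_sqrt at_top sequentially"
      unfolding filterlim_at_top eventually_sequentially by (metis le_floor_sqrt_iff)
    then have lim2: "(\<lambda>m. 2 * A (floor_sqrt m) \<omega>) \<longlonglongrightarrow> 0"
      by (rule tendsto_mult_right_zero[OF filterlim_compose[OF lim]])
    have "((\<Sum>j<m. Z j \<omega>) / real m)\<^sup>2 \<le> 2 * A (floor_sqrt m) \<omega>" if "m > 0" for m
    proof -
      define k where "k = floor_sqrt m"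
      have k: "0 < k" "k\<^sup>2 \<le> m" "m < (Suc k)\<^sup>2"
        using that Suc_floor_sqrt_power2_gt[of m] by (auto simp: k_def)
      define a where "a = (\<Sum>j<k\<^sup>2. Z j \<omega>)"
      define c where "c = (\<Sum>j\<in>{k\<^sup>2..<m}. Z j \<omega>)"
      have "{..<m} = {..<k\<^sup>2} \<union> {k\<^sup>2..<m}" using k by auto
      then have split: "(\<Sum>j<m. Z j \<omega>) = a + c"
        unfolding a_def c_def by (simp add: sum.union_disjoint ivl_disj_int)
      have "c\<^sup>2 \<le> (\<Sum>m\<in>{k\<^sup>2..<(Suc k)\<^sup>2}. (\<Sum>j\<in>{k\<^sup>2..<m}. Z j \<omega>)\<^sup>2)"
        unfolding c_def using k
        by (intro member_le_sum[where f="\<lambda>m. (\<Sum>j\<in>{k\<^sup>2..<m}. Z j \<omega>)\<^sup>2"]) auto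
      then have ac: "(a\<^sup>2 + c\<^sup>2) / real k ^ 4 \<le> A k \<omega>"
        unfolding A_def a_def by (intro divide_right_mono) auto
      have "real k ^ 4 \<le> (real m)\<^sup>2"
      proof -
        have "real (k\<^sup>2) ^ 2 \<le> real m ^ 2"
          using k by (intro power_mono of_nat_mono) auto
        then show ?thesis by (simp flip: power_mult)
      qed
      then have "((a + c) / real m)\<^sup>2 \<le> (a + c)\<^sup>2 / real k ^ 4"
        unfolding power_divide using k that by (intro divide_left_mono) auto
      also have "\<dots> \<le> (2 * (a\<^sup>2 + c\<^sup>2)) / real k ^ 4"
        using sum_squares_bound[of a c] by (intro divide_right_mono) (auto simp: power2_sum)
      also have "\<dots> \<le> 2 * A k \<omega>" using ac by (simp add: add_divide_distrib)
      finally show ?thesis by (simp add: split k_def)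
    qed
    then have "(\<lambda>m. ((\<Sum>j<m. Z j \<omega>) / real m)\<^sup>2) \<longlonglongrightarrow> 0"
      using lim2
      by (intro tendsto_sandwich[OF _ _ tendsto_const lim2])
        (auto intro!: eventually_sequentiallyI[of 1])
    then have "(\<lambda>m. sqrt (((\<Sum>j<m. Z j \<omega>) / real m)\<^sup>2)) \<longlonglongrightarrow> sqrt 0"
      by (rule tendsto_real_sqrt)
    then show ?case
      by (simp only: real_sqrt_abs real_sqrt_zero tendsto_rabs_zero_iff)
  qed
qed

text \<open>Here \<open>D j\<close> is the increment from time \<open>j\<close> to time \<open>j + 1\<close>: it is \<open>F (j + 1)\<close>-measurable and
  centred given \<open>F j\<close>.\<close>

theorem (in prob_space) SLLN_martingale_differences:
  fixes D :: "nat \<Rightarrow> 'a \<Rightarrow> real"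
  assumes sub: "\<And>j. subalgebra M (F j)"
    and mono: "\<And>i j. i \<le> j \<Longrightarrow> sets (F i) \<subseteq> sets (F j)"
    and adapted: "\<And>j. D j \<in> borel_measurable (F (Suc j))"
    and int2: "\<And>j. integrable M (\<lambda>\<omega>. (D j \<omega>)\<^sup>2)"
    and bound: "\<And>j. expectation (\<lambda>\<omega>. (D j \<omega>)\<^sup>2) \<le> C"
    and centred: "\<And>j. AE \<omega> in M. real_cond_exp M (F j) (D j) \<omega> = 0"
  shows "AE \<omega> in M. (\<lambda>m. (\<Sum>j<m. D j \<omega>) / real m) \<longlonglongrightarrow> 0"
proof (rule SLLN_orthogonal[OF _ int2 _ bound])
  show D_meas [measurable]: "D j \<in> borel_measurable M" for j
    using measurable_from_subalg[OF sub adapted] .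
  fix i j :: nat assume "i < j"
  interpret F: finite_measure_subalgebra M "F j"
    by unfold_locales (rule sub)
  have "D i \<in> borel_measurable (F j)"
    using measurable_from_subalg[OF _ adapted[of i], of "F j"] sub mono[of "Suc i" j] \<open>i < j\<close>
    by (auto simp: subalgebra_def)
  moreover have "integrable M (\<lambda>\<omega>. D i \<omega> * D j \<omega>)"
    by (rule integrable_mult_of_squares[OF D_meas D_meas int2 int2])
  ultimately have "expectation (\<lambda>\<omega>. D i \<omega> * D j \<omega>)
      = expectation (\<lambda>\<omega>. D i \<omega> * real_cond_exp M (F j) (D j) \<omega>)"
    using F.real_cond_exp_intg(2)[of "D i" "D j"] by simp
  also have "\<dots> = expectation (\<lambda>\<omega>. 0)"
    by (rule integral_cong_AE) (use centred[of j] in auto)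
  finally show "expectation (\<lambda>\<omega>. D i \<omega> * D j \<omega>) = 0" by simp
qed

section \<open>Conditional distributions and conditional expectations\<close>

text \<open>The image under \<open>h\<close> of a conditional distribution of \<open>Y\<close> is one of \<open>h \<circ> Y\<close>.\<close>

lemma is_cond_distr_distr:
  assumes prob: "prob_space M" and sub: "subalgebra M F"
    and cd: "is_cond_distr M F N Y \<kappa>" and Y [measurable]: "Y \<in> M \<rightarrow>\<^sub>M N"
    and h [measurable]: "h \<in> N \<rightarrow>\<^sub>M L"
  shows "is_cond_distr M F L (\<lambda>\<omega>. h (Y \<omega>)) (\<lambda>\<omega>. distr (\<kappa> \<omega>) L h)"
proof -
  interpret prob_space M by (rule prob)
  interpret finite_measure_subalgebra M F by unfold_locales (rule sub)
  have \<kappa>: "\<kappa> \<in> F \<rightarrow>\<^sub>M prob_algebra N"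
    using cd by (simp add: is_cond_distr_def)
  have spF: "space F = space M" using sub by (simp add: subalgebra_def)
  have "(\<lambda>\<omega>. distr (\<kappa> \<omega>) L h) \<in> F \<rightarrow>\<^sub>M prob_algebra L"
    using measurable_compose[OF \<kappa> measurable_distr_prob_space[OF h]] .
  moreover have "AE \<omega> in M. real_cond_exp M F (\<lambda>\<omega>. indicator B (h (Y \<omega>))) \<omega>
      = measure (distr (\<kappa> \<omega>) L h) B" if B [measurable]: "B \<in> sets L" for B
  proof -
    define B' where "B' = h -` B \<inter> space N"
    have B' [measurable]: "B' \<in> sets N" unfolding B'_def by measurable
    have "AE \<omega> in M. real_cond_exp M F (\<lambda>\<omega>. indicator B (h (Y \<omega>)) :: real) \<omega>
        = real_cond_exp M F (\<lambda>\<omega>. indicator B' (Y \<omega>)) \<omega>"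
      using measurable_space[OF Y]
      by (intro real_cond_exp_cong) (auto simp: B'_def indicator_def)
    moreover have "AE \<omega> in M. real_cond_exp M F (\<lambda>\<omega>. indicator B' (Y \<omega>)) \<omega> = measure (\<kappa> \<omega>) B'"
      using cd B' by (simp add: is_cond_distr_def)
    moreover have "AE \<omega> in M. measure (\<kappa> \<omega>) B' = measure (distr (\<kappa> \<omega>) L h) B"
    proof (rule AE_I2)
      fix \<omega> assume "\<omega> \<in> space M"
      then have "sets (\<kappa> \<omega>) = sets N"
        using measurable_space[OF \<kappa>] by (auto simp: spF space_prob_algebra)
      then show "measure (\<kappa> \<omega>) B' = measure (distr (\<kappa> \<omega>) L h) B"
        using measure_distr[of h "\<kappa> \<omega>" L B] h B
        by (simp add: B'_def sets_eq_imp_space_eq[of "\<kappa> \<omega>" N]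
            measurable_cong_sets[OF _ refl, of "\<kappa> \<omega>" N])
    qed
    ultimately show ?thesis by eventually_elim simp
  qed
  ultimately show ?thesis by (simp add: is_cond_distr_def)
qed

text \<open>Disintegration for nonnegative functions. For fixed \<open>A\<close>, the law of \<open>Y\<close> under the restriction
  of \<open>M\<close> to \<open>A\<close> and the mixture of the kernel under this restriction are finite measures that agree
  on every measurable set by the definition of a conditional distribution, hence have the same integrals.\<close>

lemma is_cond_distr_nn_integral:
  assumes prob: "prob_space M" and sub: "subalgebra M F"
    and cd: "is_cond_distr M F N Y \<kappa>" and Y [measurable]: "Y \<in> M \<rightarrow>\<^sub>M N"
    and A: "A \<in> sets F" and g [measurable]: "g \<in> borel_measurable N"
  shows "(\<integral>\<^sup>+\<omega>\<in>A. g (Y \<omega>) \<partial>M) = (\<integral>\<^sup>+\<omega>\<in>A. (\<integral>\<^sup>+y. g y \<partial>\<kappa> \<omega>) \<partial>M)"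
proof -
  interpret prob_space M by (rule prob)
  interpret finite_measure_subalgebra M F by unfold_locales (rule sub)
  have spF: "space F = space M" using sub by (simp add: subalgebra_def)
  have A_M [measurable]: "A \<in> sets M" using sub A by (auto simp: subalgebra_def)
  have \<kappa>F: "\<kappa> \<in> F \<rightarrow>\<^sub>M prob_algebra N"
    using cd by (simp add: is_cond_distr_def)
  have \<kappa> [measurable]: "\<kappa> \<in> M \<rightarrow>\<^sub>M subprob_algebra N"
    using measurable_prob_algebraD[OF measurable_from_subalg[OF sub \<kappa>F]] .
  define MA where "MA = density M (indicator A)"
  have \<kappa>A: "\<kappa> \<in> MA \<rightarrow>\<^sub>M subprob_algebra N" unfolding MA_def by simp
  have neA: "space MA \<noteq> {}" unfolding MA_def by (simp add: not_empty)
  have \<kappa>_prob: "prob_space (\<kappa> \<omega>)" if "\<omega> \<in> space M" for \<omega>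
    using measurable_space[OF \<kappa>F] that by (auto simp: spF space_prob_algebra)
  have "distr MA N Y = MA \<bind> \<kappa>"
  proof (rule measure_eqI)
    show "sets (distr MA N Y) = sets (MA \<bind> \<kappa>)"
      using sets_bind_measurable[OF \<kappa>A neA] by simp
    fix B assume "B \<in> sets (distr MA N Y)"
    then have B [measurable]: "B \<in> sets N" by simp
    define r where "r = real_cond_exp M F (\<lambda>\<omega>. indicator B (Y \<omega>))"
    have r: "AE \<omega> in M. r \<omega> = measure (\<kappa> \<omega>) B"
      using cd B by (simp add: is_cond_distr_def r_def)
    have int: "integrable M (\<lambda>\<omega>. indicator B (Y \<omega>) :: real)"
      by (rule integrable_const_bound[where B=1]) auto
    have "emeasure (distr MA N Y) B = (\<integral>\<^sup>+\<omega>. ennreal (indicator A \<omega> * indicator B (Y \<omega>)) \<partial>M)"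
      by (subst emeasure_distr)
        (auto simp: MA_def emeasure_density nn_integral_set_ennreal indicator_def intro!: nn_integral_cong)
    also have "\<dots> = ennreal (\<integral>\<omega>. indicator A \<omega> * indicator B (Y \<omega>) \<partial>M)"
      by (rule nn_integral_eq_integral) (auto intro!: integrable_const_bound[where B=1] simp: indicator_def)
    also have "(\<integral>\<omega>. indicator A \<omega> * indicator B (Y \<omega>) \<partial>M) = (\<integral>\<omega>\<in>A. (indicator B (Y \<omega>) :: real) \<partial>M)"
      by (simp add: set_lebesgue_integral_def)
    also have "\<dots> = (\<integral>\<omega>\<in>A. r \<omega> \<partial>M)"
      unfolding r_def by (rule real_cond_exp_intA[OF int A])
    also have "\<dots> = (\<integral>\<omega>. indicator A \<omega> * measure (\<kappa> \<omega>) B \<partial>M)"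
      unfolding set_lebesgue_integral_def by (rule integral_cong_AE) (use r in \<open>auto simp: r_def\<close>)
    also have "ennreal \<dots> = (\<integral>\<^sup>+\<omega>. ennreal (indicator A \<omega> * measure (\<kappa> \<omega>) B) \<partial>M)"
      using \<kappa>_prob
      by (intro nn_integral_eq_integral[symmetric] integrable_const_bound[where B=1])
        (auto simp: indicator_def prob_space.prob_le_1)
    also have "\<dots> = (\<integral>\<^sup>+\<omega>. emeasure (\<kappa> \<omega>) B \<partial>MA)"
      unfolding MA_def using \<kappa>_prob
      by (subst nn_integral_density)
        (auto simp: indicator_def finite_measure.emeasure_eq_measure prob_space_def intro!: nn_integral_cong)
    also have "\<dots> = emeasure (MA \<bind> \<kappa>) B"
      using emeasure_bind[OF neA \<kappa>A B] by simp
    finally show "emeasure (distr MA N Y) B = emeasure (MA \<bind> \<kappa>) B" .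
  qed
  then have "(\<integral>\<^sup>+y. g y \<partial>distr MA N Y) = (\<integral>\<^sup>+y. g y \<partial>(MA \<bind> \<kappa>))" by simp
  also have "\<dots> = (\<integral>\<^sup>+\<omega>. (\<integral>\<^sup>+y. g y \<partial>\<kappa> \<omega>) \<partial>MA)"
    by (rule nn_integral_bind[OF g \<kappa>A])
  also have "(\<integral>\<^sup>+y. g y \<partial>distr MA N Y) = (\<integral>\<^sup>+\<omega>. g (Y \<omega>) \<partial>MA)"
    by (rule nn_integral_distr) (auto simp: MA_def)
  finally show ?thesis
    unfolding MA_def by (simp add: nn_integral_density mult.commute)
qed

lemma is_cond_distr_nonneg_real_cond_exp:
  fixes q :: "'b \<Rightarrow> real"
  assumes prob: "prob_space M" and sub: "subalgebra M F"
    and cd: "is_cond_distr M F N Y \<kappa>" and Y [measurable]: "Y \<in> M \<rightarrow>\<^sub>M N"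
    and q [measurable]: "q \<in> borel_measurable N" and nonneg: "\<And>y. 0 \<le> q y"
    and intY: "integrable M (\<lambda>\<omega>. q (Y \<omega>))"
    and int\<kappa>: "\<And>\<omega>. \<omega> \<in> space M \<Longrightarrow> integrable (\<kappa> \<omega>) q"
  shows "AE \<omega> in M. real_cond_exp M F (\<lambda>\<omega>. q (Y \<omega>)) \<omega> = (\<integral>y. q y \<partial>\<kappa> \<omega>)"
proof -
  interpret prob_space M by (rule prob)
  interpret finite_measure_subalgebra M F by unfold_locales (rule sub)
  have spF: "space F = space M" using sub by (simp add: subalgebra_def)
  have \<kappa>F: "\<kappa> \<in> F \<rightarrow>\<^sub>M subprob_algebra N"
    using cd measurable_prob_algebraD by (auto simp: is_cond_distr_def)
  have gF: "(\<lambda>\<omega>. \<integral>y. q y \<partial>\<kappa> \<omega>) \<in> borel_measurable F"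
    by (rule measurable_compose[OF \<kappa>F integral_measurable_subprob_algebra]) simp
  have gM [measurable]: "(\<lambda>\<omega>. \<integral>y. q y \<partial>\<kappa> \<omega>) \<in> borel_measurable M"
    by (rule measurable_from_subalg[OF sub gF])
  have eq: "(\<integral>\<^sup>+\<omega>. ennreal (indicator A \<omega> * q (Y \<omega>)) \<partial>M)
      = (\<integral>\<^sup>+\<omega>. ennreal (indicator A \<omega> * (\<integral>y. q y \<partial>\<kappa> \<omega>)) \<partial>M)" if "A \<in> sets F" for A
  proof -
    have "(\<integral>\<^sup>+\<omega>. ennreal (indicator A \<omega> * q (Y \<omega>)) \<partial>M) = (\<integral>\<^sup>+\<omega>\<in>A. ennreal (q (Y \<omega>)) \<partial>M)"
      by (auto intro!: nn_integral_cong simp: indicator_def)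
    also have "\<dots> = (\<integral>\<^sup>+\<omega>\<in>A. (\<integral>\<^sup>+y. ennreal (q y) \<partial>\<kappa> \<omega>) \<partial>M)"
      by (rule is_cond_distr_nn_integral[OF prob sub cd Y that]) simp
    also have "\<dots> = (\<integral>\<^sup>+\<omega>. ennreal (indicator A \<omega> * (\<integral>y. q y \<partial>\<kappa> \<omega>)) \<partial>M)"
      by (intro nn_integral_cong)
        (auto simp: indicator_def nn_integral_eq_integral[OF int\<kappa>] nonneg)
    finally show ?thesis .
  qed
  have nn: "0 \<le> (\<integral>y. q y \<partial>\<kappa> \<omega>)" for \<omega>
    using nonneg by simp
  have int: "integrable M (\<lambda>\<omega>. \<integral>y. q y \<partial>\<kappa> \<omega>)"
  proof (rule integrableI_nonneg)
    have "(\<integral>\<^sup>+\<omega>. ennreal (\<integral>y. q y \<partial>\<kappa> \<omega>) \<partial>M)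
        = (\<integral>\<^sup>+\<omega>. ennreal (indicator (space M) \<omega> * (\<integral>y. q y \<partial>\<kappa> \<omega>)) \<partial>M)"
      by (intro nn_integral_cong) auto
    also have "\<dots> = (\<integral>\<^sup>+\<omega>. ennreal (indicator (space M) \<omega> * q (Y \<omega>)) \<partial>M)"
      using eq[of "space M"] sets.top[of F] by (simp add: spF)
    also have "\<dots> = (\<integral>\<^sup>+\<omega>. ennreal (q (Y \<omega>)) \<partial>M)"
      by (intro nn_integral_cong) auto
    also have "\<dots> < \<infinity>"
      using nn_integral_eq_integral[OF intY] nonneg by simp
    finally show "(\<integral>\<^sup>+\<omega>. ennreal (\<integral>y. q y \<partial>\<kappa> \<omega>) \<partial>M) < \<infinity>" .
  qed (auto simp: nn)
  show "AE \<omega> in M. real_cond_exp M F (\<lambda>\<omega>. q (Y \<omega>)) \<omega> = (\<integral>y. q y \<partial>\<kappa> \<omega>)"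
  proof (rule real_cond_exp_charact[OF _ intY int gF])
    fix A assume A: "A \<in> sets F"
    then have [measurable]: "A \<in> sets M" using sub by (auto simp: subalgebra_def)
    show "(\<integral>\<omega>\<in>A. q (Y \<omega>) \<partial>M) = (\<integral>\<omega>\<in>A. (\<integral>y. q y \<partial>\<kappa> \<omega>) \<partial>M)"
      unfolding set_lebesgue_integral_def real_scaleR_def
      by (simp add: integral_eq_nn_integral nonneg nn eq[OF A])
  qed
qed

lemma is_cond_distr_real_cond_exp:
  fixes q :: "'b \<Rightarrow> real"
  assumes prob: "prob_space M" and sub: "subalgebra M F"
    and cd: "is_cond_distr M F N Y \<kappa>" and Y [measurable]: "Y \<in> M \<rightarrow>\<^sub>M N"
    and q [measurable]: "q \<in> borel_measurable N"
    and intY: "integrable M (\<lambda>\<omega>. q (Y \<omega>))"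
    and int\<kappa>: "\<And>\<omega>. \<omega> \<in> space M \<Longrightarrow> integrable (\<kappa> \<omega>) q"
  shows "AE \<omega> in M. real_cond_exp M F (\<lambda>\<omega>. q (Y \<omega>)) \<omega> = (\<integral>y. q y \<partial>\<kappa> \<omega>)"
proof -
  interpret prob_space M by (rule prob)
  interpret finite_measure_subalgebra M F by unfold_locales (rule sub)
  define qp qm where "qp = (\<lambda>y. max (q y) 0)" and "qm = (\<lambda>y. max (- q y) 0)"
  have [measurable]: "qp \<in> borel_measurable N" "qm \<in> borel_measurable N"
    unfolding qp_def qm_def by measurable
  have q_eq: "q y = qp y - qm y" for y by (auto simp: qp_def qm_def)
  have ints: "integrable M (\<lambda>\<omega>. qp (Y \<omega>))" "integrable M (\<lambda>\<omega>. qm (Y \<omega>))"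
    using intY by (auto simp: qp_def qm_def)
  have int\<kappa>s: "integrable (\<kappa> \<omega>) qp" "integrable (\<kappa> \<omega>) qm" if "\<omega> \<in> space M" for \<omega>
    using int\<kappa>[OF that] by (auto simp: qp_def qm_def)
  have "AE \<omega> in M. real_cond_exp M F (\<lambda>\<omega>. qp (Y \<omega>)) \<omega> = (\<integral>y. qp y \<partial>\<kappa> \<omega>)"
    by (rule is_cond_distr_nonneg_real_cond_exp[OF prob sub cd Y _ _ ints(1) int\<kappa>s(1)]) (auto simp: qp_def)
  moreover have "AE \<omega> in M. real_cond_exp M F (\<lambda>\<omega>. qm (Y \<omega>)) \<omega> = (\<integral>y. qm y \<partial>\<kappa> \<omega>)"
    by (rule is_cond_distr_nonneg_real_cond_exp[OF prob sub cd Y _ _ ints(2) int\<kappa>s(2)]) (auto simp: qm_def)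
  moreover note real_cond_exp_diff[OF ints]
  moreover have "AE \<omega> in M. (\<integral>y. qp y \<partial>\<kappa> \<omega>) - (\<integral>y. qm y \<partial>\<kappa> \<omega>) = (\<integral>y. q y \<partial>\<kappa> \<omega>)"
    using Bochner_Integration.integral_diff[OF int\<kappa>s] by (auto simp: q_eq)
  ultimately show ?thesis
    unfolding q_eq by eventually_elim (simp add: q_eq)
qed

text \<open>If the kernel is a product, each component has its factor as conditional distribution.\<close>

lemma is_cond_distr_component:
  assumes prob: "prob_space M" and sub: "subalgebra M F" and "i \<in> A"
    and cd: "is_cond_distr M F (\<Pi>\<^sub>M i\<in>A. N) (\<lambda>\<omega>. \<lambda>i\<in>A. Y i \<omega>) (\<lambda>\<omega>. \<Pi>\<^sub>M i\<in>A. \<kappa> i \<omega>)"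
    and Y: "\<And>i. i \<in> A \<Longrightarrow> Y i \<in> M \<rightarrow>\<^sub>M N"
    and \<kappa>: "\<And>i \<omega>. i \<in> A \<Longrightarrow> \<omega> \<in> space M \<Longrightarrow> prob_space (\<kappa> i \<omega>) \<and> sets (\<kappa> i \<omega>) = sets N"
  shows "is_cond_distr M F N (Y i) (\<kappa> i)"
proof -
  have spF: "space F = space M" using sub by (simp add: subalgebra_def)
  have YA: "(\<lambda>\<omega>. \<lambda>i\<in>A. Y i \<omega>) \<in> M \<rightarrow>\<^sub>M (\<Pi>\<^sub>M i\<in>A. N)"
    using Y by (rule measurable_restrict)
  have proj: "(\<lambda>y. y i) \<in> (\<Pi>\<^sub>M i\<in>A. N) \<rightarrow>\<^sub>M N"
    using measurable_component_singleton[OF \<open>i \<in> A\<close>] .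
  have marg: "distr (\<Pi>\<^sub>M i\<in>A. \<kappa> i \<omega>) N (\<lambda>y. y i) = \<kappa> i \<omega>" if "\<omega> \<in> space M" for \<omega>
  proof -
    have "distr (\<Pi>\<^sub>M i\<in>A. \<kappa> i \<omega>) N (\<lambda>y. y i) = distr (\<Pi>\<^sub>M i\<in>A. \<kappa> i \<omega>) (\<kappa> i \<omega>) (\<lambda>y. y i)"
      using \<kappa>[OF \<open>i \<in> A\<close> that] by (intro distr_cong) auto
    also have "\<dots> = \<kappa> i \<omega>"
      using \<kappa> that \<open>i \<in> A\<close> by (intro distr_PiM_component) auto
    finally show ?thesis .
  qed
  from is_cond_distr_distr[OF prob sub cd YA proj]
  have "is_cond_distr M F N (Y i) (\<lambda>\<omega>. distr (\<Pi>\<^sub>M i\<in>A. \<kappa> i \<omega>) N (\<lambda>y. y i))"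
    using \<open>i \<in> A\<close> by simp
  moreover have "(\<lambda>\<omega>. distr (\<Pi>\<^sub>M i\<in>A. \<kappa> i \<omega>) N (\<lambda>y. y i)) \<in> F \<rightarrow>\<^sub>M prob_algebra N
      \<longleftrightarrow> \<kappa> i \<in> F \<rightarrow>\<^sub>M prob_algebra N"
    by (rule measurable_cong) (simp add: marg spF)
  ultimately show ?thesis
    unfolding is_cond_distr_def by (auto simp: marg elim!: AE_mp)
qed

section \<open>Information carried by a determinant-maximizing stage\<close>

lemma continuous_on_det: "continuous_on S (det :: real^'n^'n \<Rightarrow> real)"
  unfolding det_def by (intro continuous_intros)

text \<open>The matrices with \<open>norm A \<le> R\<close> and \<open>\<delta> \<le> \<bar>det A\<bar>\<close> form a compact set, so \<open>norm (A *v v)\<close> attains a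
  positive minimum over these \<open>A\<close> and the unit vectors \<open>v\<close>.\<close>

lemma det_bounded_below_imp_coercive:
  fixes R \<delta> :: real
  assumes "0 < \<delta>"
  obtains c where "0 < c"
    "\<And>(A :: real^'n^'n) v. norm A \<le> R \<Longrightarrow> \<delta> \<le> \<bar>det A\<bar> \<Longrightarrow> c * (norm v)\<^sup>2 \<le> (norm (A *v v))\<^sup>2"
proof -
  define S where "S = {A :: real^'n^'n. norm A \<le> R \<and> \<delta> \<le> \<bar>det A\<bar>}"
  have "S = cball 0 R \<inter> {A. \<delta> \<le> \<bar>det A\<bar>}"
    by (auto simp: S_def)
  moreover have "closed {A :: real^'n^'n. \<delta> \<le> \<bar>det A\<bar>}"
    by (intro closed_Collect_le continuous_on_rabs continuous_on_const continuous_on_det)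
  ultimately have "compact S"
    by (auto intro: compact_Int_closed)
  then have comp: "compact (S \<times> sphere (0 :: real^'n) 1)"
    by (intro compact_Times) auto
  have cont: "continuous_on (S \<times> sphere (0 :: real^'n) 1) (\<lambda>(A, v). (norm (A *v v))\<^sup>2)"
    unfolding matrix_vector_mult_def split_beta by (intro continuous_intros)
  show thesis
  proof (cases "S = {}")
    case True
    then show thesis using that[of 1] by (auto simp: S_def)
  next
    case False
    then have "S \<times> sphere (0 :: real^'n) 1 \<noteq> {}" by (auto simp: sphere_eq_empty)
    from continuous_attains_inf[OF comp this cont]
    obtain A0 v0 where 0: "A0 \<in> S" "norm v0 = 1"
      and min: "\<And>A v. A \<in> S \<Longrightarrow> norm v = 1 \<Longrightarrow> (norm (A0 *v v0))\<^sup>2 \<le> (norm (A *v v))\<^sup>2"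
      by fastforce
    define c where "c = (norm (A0 *v v0))\<^sup>2"
    have "det A0 \<noteq> 0" using 0 \<open>0 < \<delta>\<close> by (auto simp: S_def)
    then have "invertible A0" by (simp add: invertible_det_nz)
    then have "A0 *v v0 \<noteq> 0"
      using 0(2) by (metis invertible_def matrix_left_invertible_ker norm_zero zero_neq_one)
    then have "0 < c" by (simp add: c_def)
    moreover have "c * (norm v)\<^sup>2 \<le> (norm (A *v v))\<^sup>2" if "norm A \<le> R" "\<delta> \<le> \<bar>det A\<bar>" for A and v :: "real^'n"
    proof (cases "v = 0")
      case False
      have "c \<le> (norm (A *v (inverse (norm v) *\<^sub>R v)))\<^sup>2"
        unfolding c_def using that False by (intro min) (auto simp: S_def)
      also have "\<dots> = (norm (A *v v))\<^sup>2 / (norm v)\<^sup>2"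
        by (simp add: matrix_vector_mult_scaleR power_mult_distrib power_divide power_inverse divide_inverse mult.commute)
      finally show ?thesis using False by (simp add: pos_le_divide_eq)
    qed simp
    ultimately show thesis using that[of c] by blast
  qed
qed

text \<open>The numbering of the columns used in the definition of \<open>det_cols\<close>.\<close>

lemma bij_betw_column_number:
  "bij_betw (\<lambda>j :: 'p::finite. to_nat_on UNIV j + 1) UNIV {1..CARD('p)}"
proof -
  have "bij_betw (to_nat_on (UNIV :: 'p set)) UNIV {..<CARD('p)}"
    by (rule to_nat_on_finite) simp
  moreover have "bij_betw (\<lambda>i. i + 1) {..<CARD('p)} {1..CARD('p)}"
    by (rule bij_betw_byWitness[where f'="\<lambda>i. i - 1"]) auto
  ultimately have "bij_betw ((\<lambda>i. i + 1) \<circ> to_nat_on (UNIV :: 'p set)) UNIV {1..CARD('p)}"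
    by (rule bij_betw_trans)
  then show ?thesis by (simp add: comp_def)
qed

lemma det_cols_scaleR:
  fixes v :: "nat \<Rightarrow> real ^ 'p"
  shows "det_cols (\<lambda>j. c j *\<^sub>R v j) = (\<Prod>j=1..CARD('p). c j) * det_cols v"
proof -
  let ?\<pi> = "\<lambda>j :: 'p. to_nat_on UNIV j + 1"
  have "det_cols (\<lambda>j. c j *\<^sub>R v j) = det (transpose (\<chi> j. c (?\<pi> j) *s v (?\<pi> j)))"
    unfolding det_cols_def transpose_def by (rule arg_cong[where f=det]) (simp add: vec_eq_iff)
  also have "\<dots> = (\<Prod>j\<in>UNIV. c (?\<pi> j)) * det (transpose (\<chi> j. v (?\<pi> j)))"
    unfolding det_transpose by (rule det_rows_mul)
  also have "det (transpose (\<chi> j. v (?\<pi> j))) = det_cols v"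
    unfolding det_cols_def transpose_def by (rule arg_cong[where f=det]) (simp add: vec_eq_iff)
  also have "(\<Prod>j\<in>UNIV. c (?\<pi> j)) = (\<Prod>j=1..CARD('p). c j)"
    by (rule prod.reindex_bij_betw[OF bij_betw_column_number])
  finally show ?thesis .
qed

lemma span_image_imp_det_cols_nonzero:
  fixes g :: "'x \<Rightarrow> real ^ 'p"
  assumes "span (g ` S) = UNIV"
  obtains z where "z \<in> {1..CARD('p)} \<rightarrow> S" "det_cols (\<lambda>j. g (z j)) \<noteq> 0"
proof -
  let ?\<pi> = "\<lambda>j :: 'p. to_nat_on UNIV j + 1"
  obtain B where B: "B \<subseteq> g ` S" "independent B" "g ` S \<subseteq> span B" "card B = dim (g ` S)"
    by (rule basis_exists)
  have spB: "span B = UNIV"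
    using B(3) assms by (metis span_minimal subspace_span top.extremum_uniqueI)
  have "card B = CARD('p)"
    using B(4) assms by (metis dim_UNIV dim_span DIM_cart DIM_real mult.right_neutral)
  moreover have "finite B" using B(2) independent_imp_finite by blast
  ultimately obtain h where h: "bij_betw h (UNIV :: 'p set) B"
    using finite_same_card_bij[of "UNIV :: 'p set" B] by auto
  have "\<forall>j. \<exists>x\<in>S. g x = h j"
  proof
    fix j
    have "h j \<in> g ` S" using bij_betwE[OF h] B(1) by blast
    then show "\<exists>x\<in>S. g x = h j" by (metis imageE)
  qed
  then obtain w where w: "\<And>j. w j \<in> S" "\<And>j. g (w j) = h j" by metis
  define z where "z i = w (inv_into UNIV ?\<pi> i)" for i
  have z: "z (?\<pi> j) = w j" for j
    unfolding z_def by (subst inv_into_f_f) (use bij_betw_column_number in \<open>auto simp: bij_betw_def\<close>)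
  define A :: "real^'p^'p" where "A = (\<chi> i j. h j $ i)"
  have "columns A = range h"
    by (auto simp: columns_def column_def A_def image_def)
  then have "vec.span (columns A) = UNIV"
    using h spB by (simp add: bij_betw_def span_vec_eq)
  then have "det A \<noteq> 0"
    using matrix_right_invertible_span_columns[of A] by (simp add: invertible_right_inverse flip: invertible_det_nz)
  moreover have "det_cols (\<lambda>j. g (z j)) = det A"
    unfolding det_cols_def A_def using z w by simp
  moreover have "z \<in> {1..CARD('p)} \<rightarrow> S" using w by (auto simp: z_def)
  ultimately show thesis using that by auto
qed

lemma det_cols_bounded_below_imp_information:
  fixes f :: "'x \<Rightarrow> real ^ 'p"
  assumes bound: "\<And>x. x \<in> S \<Longrightarrow> norm (f x) \<le> R" and "0 < \<delta>"
  shows "\<exists>c>0. \<forall>x\<in>{1..CARD('p)} \<rightarrow> S. \<forall>v. \<delta> \<le> \<bar>det_cols (\<lambda>j. f (x j))\<bar>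
    \<longrightarrow> c * (norm v)\<^sup>2 \<le> (\<Sum>j=1..CARD('p). (f (x j) \<bullet> v)\<^sup>2)"
proof -
  let ?\<pi> = "\<lambda>j :: 'p. to_nat_on UNIV j + 1"
  obtain c where c: "0 < c" "\<And>(A :: real^'p^'p) v. norm A \<le> CARD('p) * R \<Longrightarrow> \<delta> \<le> \<bar>det A\<bar>
      \<Longrightarrow> c * (norm v)\<^sup>2 \<le> (norm (A *v v))\<^sup>2"
    using det_bounded_below_imp_coercive[OF \<open>0 < \<delta>\<close>, of "CARD('p) * R"] by auto
  have "c * (norm v)\<^sup>2 \<le> (\<Sum>j=1..CARD('p). (f (x j) \<bullet> v)\<^sup>2)"
    if x: "x \<in> {1..CARD('p)} \<rightarrow> S" and d: "\<delta> \<le> \<bar>det_cols (\<lambda>j. f (x j))\<bar>" for x v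
  proof -
    define A where "A = (\<chi> j. f (x (?\<pi> j)))"
    have \<pi>: "?\<pi> j \<in> {1..CARD('p)}" for j
      using bij_betwE[OF bij_betw_column_number] by auto
    have "norm A \<le> (\<Sum>j\<in>UNIV. norm (A $ j))"
      unfolding norm_vec_def[of A] by (rule L2_set_le_sum) simp
    also have "\<dots> \<le> (\<Sum>j\<in>(UNIV :: 'p set). R)"
    proof (rule sum_mono)
      show "norm (A $ j) \<le> R" for j
        using bound[OF funcset_mem[OF x \<pi>[of j]]] by (simp add: A_def)
    qed
    finally have "norm A \<le> CARD('p) * R" by simp
    moreover have "det A = det_cols (\<lambda>j. f (x j))"
      unfolding det_cols_def by (subst det_transpose[symmetric])
        (rule arg_cong[where f=det], simp add: vec_eq_iff transpose_def A_def)
    ultimately have "c * (norm v)\<^sup>2 \<le> (norm (A *v v))\<^sup>2"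
      using d by (intro c(2)) auto
    also have "\<dots> = (\<Sum>j\<in>UNIV. (f (x (?\<pi> j)) \<bullet> v)\<^sup>2)"
      unfolding power2_norm_eq_inner inner_vec_def[of "A *v v"] matrix_vector_mul_component
      by (simp add: A_def power2_eq_square)
    also have "\<dots> = (\<Sum>j=1..CARD('p). (f (x j) \<bullet> v)\<^sup>2)"
      by (rule sum.reindex_bij_betw[OF bij_betw_column_number])
    finally show ?thesis .
  qed
  with c(1) show ?thesis by blast
qed

text \<open>The design points of one stage are informative, uniformly over the parameter value at which the
  determinant criterion was evaluated: since \<open>g \<theta> = \<psi> * f\<close> with \<open>\<psi>\<close> between two positive constants,
  a maximizer of the determinant for \<open>g \<theta>\<close> has a determinant for \<open>f\<close> that is bounded away from \<open>0\<close>.\<close>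

lemma det_maximizing_information:
  fixes f :: "'x::metric_space \<Rightarrow> real ^ 'p" and \<Theta> :: "(real ^ 'p) set"
  assumes X: "compact S" and \<Theta>: "compact \<Theta>" and f: "continuous_on S f"
    and \<psi>: "continuous_on (S \<times> \<Theta>) (\<lambda>(x, \<theta>). \<psi> x \<theta>)"
    and \<psi>_pos: "\<And>x \<theta>. x \<in> S \<Longrightarrow> \<theta> \<in> \<Theta> \<Longrightarrow> 0 < \<psi> x \<theta>"
    and g: "\<And>x \<theta>. x \<in> S \<Longrightarrow> \<theta> \<in> \<Theta> \<Longrightarrow> g \<theta> x = \<psi> x \<theta> *\<^sub>R f x"
    and span: "\<And>\<theta>. \<theta> \<in> \<Theta> \<Longrightarrow> span (g \<theta> ` S) = UNIV"
  shows "\<exists>c>0. \<forall>\<theta>\<in>\<Theta>. \<forall>x v. det_maximizing S (g \<theta>) x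
    \<longrightarrow> c * (norm v)\<^sup>2 \<le> (\<Sum>j=1..CARD('p). (f (x j) \<bullet> v)\<^sup>2)"
proof (cases "\<Theta> = {}")
  case True
  then show ?thesis using zero_less_one by blast
next
  case False
  then obtain \<theta>0 where \<theta>0: "\<theta>0 \<in> \<Theta>" by auto
  let ?p = "CARD('p)"
  obtain z where z: "z \<in> {1..?p} \<rightarrow> S" and "det_cols (\<lambda>j. g \<theta>0 (z j)) \<noteq> 0"
    using span_image_imp_det_cols_nonzero[OF span[OF \<theta>0]] by blast
  have scale: "\<bar>det_cols (\<lambda>j. g \<theta> (x j))\<bar> = (\<Prod>j=1..?p. \<psi> (x j) \<theta>) * \<bar>det_cols (\<lambda>j. f (x j))\<bar>"
    if "\<theta> \<in> \<Theta>" "x \<in> {1..?p} \<rightarrow> S" for \<theta> x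
  proof -
    have "to_nat_on (UNIV :: 'p set) j + 1 \<in> {1..?p}" for j
      using bij_betwE[OF bij_betw_column_number] by auto
    then have "x (to_nat_on (UNIV :: 'p set) j + 1) \<in> S" for j
      using that(2) by blast
    then have "det_cols (\<lambda>j. g \<theta> (x j)) = det_cols (\<lambda>j. \<psi> (x j) \<theta> *\<^sub>R f (x j))"
      unfolding det_cols_def using g[OF _ that(1)] by simp
    moreover have "0 < (\<Prod>j=1..?p. \<psi> (x j) \<theta>)"
      using that \<psi>_pos by (intro prod_pos) blast
    ultimately show ?thesis
      by (simp only: det_cols_scaleR abs_mult abs_of_pos)
  qed
  have fz: "\<bar>det_cols (\<lambda>j. f (z j))\<bar> > 0"
    using \<open>det_cols (\<lambda>j. g \<theta>0 (z j)) \<noteq> 0\<close> scale[OF \<theta>0 z] by auto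
  have "z 1 \<in> S" using z by (auto simp: Pi_iff Suc_le_eq)
  then have ne: "S \<times> \<Theta> \<noteq> {}" using False by auto
  note comp = compact_Times[OF X \<Theta>]
  obtain m where m: "0 < m" "\<And>x \<theta>. x \<in> S \<Longrightarrow> \<theta> \<in> \<Theta> \<Longrightarrow> m \<le> \<psi> x \<theta>"
  proof -
    obtain y where y: "y \<in> S \<times> \<Theta>"
      "\<forall>z\<in>S \<times> \<Theta>. (case y of (x, \<theta>) \<Rightarrow> \<psi> x \<theta>) \<le> (case z of (x, \<theta>) \<Rightarrow> \<psi> x \<theta>)"
      using continuous_attains_inf[OF comp ne \<psi>] by blast
    show thesis
    proof (rule that)
      show "0 < \<psi> (fst y) (snd y)" using y(1) by (auto intro: \<psi>_pos)
      show "\<psi> (fst y) (snd y) \<le> \<psi> x \<theta>" if "x \<in> S" "\<theta> \<in> \<Theta>" for x \<theta>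
        using bspec[OF y(2), of "(x, \<theta>)"] that by (simp add: split_beta)
    qed
  qed
  obtain m' where m': "\<And>x \<theta>. x \<in> S \<Longrightarrow> \<theta> \<in> \<Theta> \<Longrightarrow> \<psi> x \<theta> \<le> m'"
  proof -
    obtain y where y: "y \<in> S \<times> \<Theta>"
      "\<forall>z\<in>S \<times> \<Theta>. (case z of (x, \<theta>) \<Rightarrow> \<psi> x \<theta>) \<le> (case y of (x, \<theta>) \<Rightarrow> \<psi> x \<theta>)"
      using continuous_attains_sup[OF comp ne \<psi>] by blast
    show thesis
    proof (rule that)
      show "\<psi> x \<theta> \<le> \<psi> (fst y) (snd y)" if "x \<in> S" "\<theta> \<in> \<Theta>" for x \<theta>
        using bspec[OF y(2), of "(x, \<theta>)"] that by (simp add: split_beta)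
    qed
  qed
  have "0 < m'" using m'[OF \<open>z 1 \<in> S\<close> \<theta>0] \<psi>_pos[OF \<open>z 1 \<in> S\<close> \<theta>0] by simp
  \<comment> \<open>Comparing the maximizer with the fixed tuple \<open>z\<close> costs at most the factor \<open>(m / m')\<^sup>p\<close>.\<close>
  define \<delta> where "\<delta> = m ^ ?p * \<bar>det_cols (\<lambda>j. f (z j))\<bar> / m' ^ ?p"
  have "0 < \<delta>" unfolding \<delta>_def using m(1) \<open>0 < m'\<close> fz by simp
  have "bounded (f ` S)" using compact_continuous_image[OF f X] by (rule compact_imp_bounded)
  then obtain R where R: "\<And>x. x \<in> S \<Longrightarrow> norm (f x) \<le> R" by (auto simp: bounded_iff)
  obtain c where "0 < c" and c: "\<forall>x\<in>{1..?p} \<rightarrow> S. \<forall>v. \<delta> \<le> \<bar>det_cols (\<lambda>j. f (x j))\<bar>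
      \<longrightarrow> c * (norm v)\<^sup>2 \<le> (\<Sum>j=1..?p. (f (x j) \<bullet> v)\<^sup>2)"
    using det_cols_bounded_below_imp_information[where f=f, OF R \<open>0 < \<delta>\<close>] by blast
  show ?thesis
  proof (intro exI[of _ c] conjI ballI allI impI \<open>0 < c\<close>)
    fix \<theta> x and v :: "real ^ 'p" assume \<theta>: "\<theta> \<in> \<Theta>" and max: "det_maximizing S (g \<theta>) x"
    then have x: "x \<in> {1..?p} \<rightarrow> S" by (simp add: det_maximizing_def)
    have "m ^ ?p * \<bar>det_cols (\<lambda>j. f (z j))\<bar> \<le> (\<Prod>j=1..?p. \<psi> (z j) \<theta>) * \<bar>det_cols (\<lambda>j. f (z j))\<bar>"
      using prod_mono[of "{1..?p}" "\<lambda>_. m" "\<lambda>j. \<psi> (z j) \<theta>"] m z \<theta>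
      by (intro mult_right_mono) (auto simp: Pi_iff less_imp_le)
    also have "\<dots> = \<bar>det_cols (\<lambda>j. g \<theta> (z j))\<bar>"
      by (rule scale[OF \<theta> z, symmetric])
    also have "\<dots> \<le> \<bar>det_cols (\<lambda>j. g \<theta> (x j))\<bar>"
      using max z unfolding det_maximizing_def abs_le_square_iff by blast
    also have "\<dots> = (\<Prod>j=1..?p. \<psi> (x j) \<theta>) * \<bar>det_cols (\<lambda>j. f (x j))\<bar>"
      by (rule scale[OF \<theta> x])
    also have "\<dots> \<le> m' ^ ?p * \<bar>det_cols (\<lambda>j. f (x j))\<bar>"
      using prod_mono[of "{1..?p}" "\<lambda>j. \<psi> (x j) \<theta>" "\<lambda>_. m'"] m' \<psi>_pos x \<theta>
      by (intro mult_right_mono) (auto simp: Pi_iff less_imp_le)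
    finally have "\<delta> \<le> \<bar>det_cols (\<lambda>j. f (x j))\<bar>"
      unfolding \<delta>_def using \<open>0 < m'\<close> by (simp add: divide_le_eq mult.commute)
    then show "c * (norm v)\<^sup>2 \<le> (\<Sum>j=1..?p. (f (x j) \<bullet> v)\<^sup>2)"
      using c x by blast
  qed
qed

section \<open>Calculus and moments in the exponential family\<close>

context exponential_family
begin

lemma b_has_derivative: "\<tau> \<in> J \<Longrightarrow> (b has_real_derivative deriv b \<tau>) (at \<tau>)"
  using b_smooth[of \<tau> 0] by (simp add: DERIV_deriv_iff_real_differentiable)

lemma deriv_b_has_derivative: "\<tau> \<in> J \<Longrightarrow> (deriv b has_real_derivative deriv (deriv b) \<tau>) (at \<tau>)"
  using b_smooth[of \<tau> 1] by (simp add: DERIV_deriv_iff_real_differentiable)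

lemma continuous_on_deriv_b: "continuous_on J (deriv b)"
  by (intro continuous_at_imp_continuous_on ballI DERIV_isCont[OF deriv_b_has_derivative])

lemma continuous_on_deriv2_b: "continuous_on J (deriv (deriv b))"
proof (intro continuous_at_imp_continuous_on ballI)
  fix \<tau> assume "\<tau> \<in> J"
  then show "isCont (deriv (deriv b)) \<tau>"
    using differentiable_imp_continuous_within[OF b_smooth[of \<tau> 2]] by (simp add: numeral_2_eq_2)
qed

lemma Icc_subset_J: "s \<in> J \<Longrightarrow> t \<in> J \<Longrightarrow> {s..t} \<subseteq> J"
  using J_interval unfolding is_interval_1 by (meson atLeastAtMost_iff subsetI)

lemma deriv_b_strict_mono:
  assumes "s \<in> J" "t \<in> J" "s < t"
  shows "deriv b s < deriv b t"
proof (rule DERIV_pos_imp_increasing[OF \<open>s < t\<close>])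
  fix x assume "s \<le> x" "x \<le> t"
  then have "x \<in> J" using Icc_subset_J[OF assms(1,2)] by auto
  then show "\<exists>y. (deriv b has_real_derivative y) (at x) \<and> 0 < y"
    using deriv_b_has_derivative variance_pos by blast
qed

lemma inj_on_deriv_b: "inj_on (deriv b) J"
  by (rule inj_onI) (metis deriv_b_strict_mono less_irrefl linorder_neqE)

lemma mean_inv_in_J: "v \<in> deriv b ` J \<Longrightarrow> mean_inv J b v \<in> J"
  unfolding mean_inv_def by (rule the_inv_into_into[OF inj_on_deriv_b]) auto

lemma deriv_b_mean_inv: "v \<in> deriv b ` J \<Longrightarrow> deriv b (mean_inv J b v) = v"
  unfolding mean_inv_def by (rule f_the_inv_into_f[OF inj_on_deriv_b])

lemma mean_inv_strict_mono:
  assumes "v \<in> deriv b ` J" "w \<in> deriv b ` J" "v < w"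
  shows "mean_inv J b v < mean_inv J b w"
proof (rule ccontr)
  assume "\<not> ?thesis"
  then consider "mean_inv J b w < mean_inv J b v" | "mean_inv J b w = mean_inv J b v" by linarith
  then show False
    using deriv_b_strict_mono[OF mean_inv_in_J[OF assms(2)] mean_inv_in_J[OF assms(1)]]
      deriv_b_mean_inv[OF assms(1)] deriv_b_mean_inv[OF assms(2)] assms(3)
    by cases auto
qed

lemma deriv2_b_bounds:
  assumes "{s..t} \<subseteq> J"
  shows "\<exists>\<beta>>0. \<exists>B>0. \<forall>\<tau>\<in>{s..t}. \<beta> \<le> deriv (deriv b) \<tau> \<and> deriv (deriv b) \<tau> \<le> B"
proof (cases "{s..t} = {}")
  case True
  then show ?thesis using zero_less_one by blast
next
  case False
  have cont: "continuous_on {s..t} (deriv (deriv b))"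
    using continuous_on_deriv2_b assms by (rule continuous_on_subset)
  obtain x where x: "x \<in> {s..t}" "\<forall>y\<in>{s..t}. deriv (deriv b) x \<le> deriv (deriv b) y"
    using continuous_attains_inf[OF compact_Icc False cont] by blast
  obtain x' where x': "x' \<in> {s..t}" "\<forall>y\<in>{s..t}. deriv (deriv b) y \<le> deriv (deriv b) x'"
    using continuous_attains_sup[OF compact_Icc False cont] by blast
  have "0 < deriv (deriv b) x" "0 < deriv (deriv b) x'"
    using x(1) x'(1) variance_pos assms by blast+
  then show ?thesis using x(2) x'(2) by blast
qed

lemma b_strongly_convex:
  assumes "{s..t} \<subseteq> J"
  shows "\<exists>\<beta>>0. \<forall>x\<in>{s..t}. \<forall>y\<in>{s..t}. \<beta> * (y - x)\<^sup>2 \<le> b y - b x - deriv b x * (y - x)"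
proof -
  obtain \<beta> B where \<beta>: "0 < \<beta>" "\<And>\<tau>. \<tau> \<in> {s..t} \<Longrightarrow> \<beta> \<le> deriv (deriv b) \<tau>"
    using deriv2_b_bounds[OF assms] by blast
  \<comment> \<open>Subtracting the parabola \<open>\<beta>/2 * x\<^sup>2\<close> leaves a convex function, which lies above its tangents.\<close>
  define g where "g x = b x - \<beta> / 2 * x\<^sup>2" for x
  define g' where "g' x = deriv b x - \<beta> * x" for x
  have g: "(g has_real_derivative g' x) (at x)" if "x \<in> {s..t}" for x
    unfolding g_def g'_def using b_has_derivative[of x] that assms
    by (auto intro!: derivative_eq_intros)
  have g': "(g' has_real_derivative (deriv (deriv b) x - \<beta>)) (at x)" if "x \<in> {s..t}" for x
    unfolding g'_def using deriv_b_has_derivative[of x] that assms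
    by (auto intro!: derivative_eq_intros)
  show ?thesis
  proof (intro exI[of _ "\<beta> / 2"] conjI ballI)
    fix x y assume xy: "x \<in> {s..t}" "y \<in> {s..t}"
    have "g' x * (y - x) \<le> g y - g x"
      using xy \<beta>(2)
      by (intro f''_imp_f'[of "{s..t}" g g' "\<lambda>x. deriv (deriv b) x - \<beta>"])
        (auto intro: g g')
    then show "\<beta> / 2 * (y - x)\<^sup>2 \<le> b y - b x - deriv b x * (y - x)"
      by (simp add: g_def g'_def power2_eq_square algebra_simps)
  qed (use \<beta>(1) in simp)
qed

text \<open>The natural parameter as a function of the linear predictor is \<open>(b')\<^sup>-\<^sup>1 \<circ> G\<close>. The mean value
  theorem for \<open>G\<close> and for \<open>b'\<close> bounds its difference quotients on a compact interval from both sides,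
  and its monotonicity keeps its values in a compact subinterval of \<open>J\<close>.\<close>

lemma natural_parameter_bilipschitz:
  assumes sub: "{u0..u1} \<subseteq> I" and ne: "u0 \<le> u1"
    and G: "\<And>u. u \<in> I \<Longrightarrow> G differentiable (at u)" and G'_cont: "continuous_on I (deriv G)"
    and G'_pos: "\<And>u. u \<in> I \<Longrightarrow> 0 < deriv G u"
    and G_sub: "G ` I \<subseteq> deriv b ` J"
  shows "\<exists>s t. \<exists>c>0. \<exists>c'>0. {s..t} \<subseteq> J \<and> (\<forall>u\<in>{u0..u1}. mean_inv J b (G u) \<in> {s..t}) \<and>
    (\<forall>u\<in>{u0..u1}. \<forall>v\<in>{u0..u1}.
      c * \<bar>u - v\<bar> \<le> \<bar>mean_inv J b (G u) - mean_inv J b (G v)\<bar> \<and>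
      \<bar>mean_inv J b (G u) - mean_inv J b (G v)\<bar> \<le> c' * \<bar>u - v\<bar>)"
proof -
  define T where "T u = mean_inv J b (G u)" for u
  have ne': "{u0..u1} \<noteq> {}" using ne by simp
  have cont: "continuous_on {u0..u1} (deriv G)"
    using G'_cont sub by (rule continuous_on_subset)
  obtain x where x: "x \<in> {u0..u1}" "\<forall>y\<in>{u0..u1}. deriv G x \<le> deriv G y"
    using continuous_attains_inf[OF compact_Icc ne' cont] by blast
  obtain x' where x': "x' \<in> {u0..u1}" "\<forall>y\<in>{u0..u1}. deriv G y \<le> deriv G x'"
    using continuous_attains_sup[OF compact_Icc ne' cont] by blast
  define \<gamma> \<Gamma> where "\<gamma> = deriv G x" and "\<Gamma> = deriv G x'"
  have \<gamma>: "0 < \<gamma>" "0 < \<Gamma>" using G'_pos x(1) x'(1) sub by (auto simp: \<gamma>_def \<Gamma>_def)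
  have G_mvt: "\<exists>z\<in>{u0..u1}. G v - G u = (v - u) * deriv G z" if "u \<in> {u0..u1}" "v \<in> {u0..u1}" "u < v" for u v
  proof -
    have "\<exists>z. u < z \<and> z < v \<and> G v - G u = (v - u) * deriv G z"
      using that sub G by (intro MVT2) (auto simp: DERIV_deriv_iff_real_differentiable subset_iff)
    then show ?thesis using that by force
  qed
  have G_mem: "G u \<in> deriv b ` J" if "u \<in> {u0..u1}" for u
    using that sub G_sub by blast
  have T_J: "T u \<in> J" if "u \<in> {u0..u1}" for u
    unfolding T_def using mean_inv_in_J[OF G_mem[OF that]] .
  have T_less: "T u < T v" if uv: "u \<in> {u0..u1}" "v \<in> {u0..u1}" "u < v" for u v
  proof -
    obtain z where z: "z \<in> {u0..u1}" "G v - G u = (v - u) * deriv G z" using G_mvt[OF uv] by blast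
    have "0 < deriv G z" using z(1) sub G'_pos by blast
    then have "0 < (v - u) * deriv G z" using uv by simp
    then have "G u < G v" using z(2) by linarith
    then show ?thesis
      unfolding T_def using uv by (intro mean_inv_strict_mono G_mem)
  qed
  have Tsub: "{T u0..T u1} \<subseteq> J"
    using ne by (intro Icc_subset_J T_J) auto
  have T_mem: "T u \<in> {T u0..T u1}" if "u \<in> {u0..u1}" for u
    using T_less[of u0 u] T_less[of u u1] that ne by (cases "u = u0"; cases "u = u1") auto
  obtain \<beta> B where \<beta>: "0 < \<beta>" "0 < B"
    "\<forall>\<tau>\<in>{T u0..T u1}. \<beta> \<le> deriv (deriv b) \<tau> \<and> deriv (deriv b) \<tau> \<le> B"
    using deriv2_b_bounds[OF Tsub] by blast
  have main: "\<gamma> / B * (v - u) \<le> T v - T u \<and> T v - T u \<le> \<Gamma> / \<beta> * (v - u)"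
    if uv: "u \<in> {u0..u1}" "v \<in> {u0..u1}" "u < v" for u v
  proof -
    obtain z where z: "z \<in> {u0..u1}" "G v - G u = (v - u) * deriv G z" using G_mvt[OF uv] by blast
    have lt: "T u < T v" by (rule T_less[OF uv])
    have "\<exists>w. T u < w \<and> w < T v \<and> deriv b (T v) - deriv b (T u) = (T v - T u) * deriv (deriv b) w"
      using lt Icc_subset_J[OF T_J[OF uv(1)] T_J[OF uv(2)]]
      by (intro MVT2 deriv_b_has_derivative) auto
    then obtain w where w: "T u < w" "w < T v"
      "deriv b (T v) - deriv b (T u) = (T v - T u) * deriv (deriv b) w" by blast
    have "w \<in> {T u0..T u1}" using w(1,2) T_mem[OF uv(1)] T_mem[OF uv(2)] by auto
    then have bw: "\<beta> \<le> deriv (deriv b) w" "deriv (deriv b) w \<le> B" using \<beta>(3) by auto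
    have gz: "\<gamma> \<le> deriv G z" "deriv G z \<le> \<Gamma>" using x x' z(1) by (auto simp: \<gamma>_def \<Gamma>_def)
    have eq: "(v - u) * deriv G z = (T v - T u) * deriv (deriv b) w"
      using w(3) z(2) uv deriv_b_mean_inv[OF G_mem] by (simp add: T_def)
    have "(v - u) * \<gamma> \<le> (v - u) * deriv G z" using gz uv by (intro mult_left_mono) auto
    also have "\<dots> \<le> (T v - T u) * B" unfolding eq using bw lt by (intro mult_left_mono) auto
    finally have 1: "\<gamma> / B * (v - u) \<le> T v - T u" using \<beta>(2) by (simp add: field_simps)
    have "(T v - T u) * \<beta> \<le> (T v - T u) * deriv (deriv b) w" using bw lt by (intro mult_left_mono) auto
    also have "\<dots> \<le> (v - u) * \<Gamma>" unfolding eq[symmetric] using gz uv by (intro mult_left_mono) auto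
    finally have "T v - T u \<le> \<Gamma> / \<beta> * (v - u)" using \<beta>(1) by (simp add: field_simps)
    with 1 show ?thesis by simp
  qed
  have main': "\<gamma> / B * \<bar>u - v\<bar> \<le> \<bar>T u - T v\<bar> \<and> \<bar>T u - T v\<bar> \<le> \<Gamma> / \<beta> * \<bar>u - v\<bar>"
    if uv: "u \<in> {u0..u1}" "v \<in> {u0..u1}" for u v
  proof (cases u v rule: linorder_cases)
    case less
    then show ?thesis
      using main[OF uv less] T_less[OF uv less] by (simp only: abs_of_neg diff_less_0_iff_less minus_diff_eq)
  next
    case greater
    then show ?thesis
      using main[OF uv(2,1) greater] T_less[OF uv(2,1) greater] by (simp only: abs_of_pos diff_gt_0_iff_gt)
  qed simp
  have "0 < \<gamma> / B" "0 < \<Gamma> / \<beta>" using \<gamma> \<beta>(1,2) by auto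
  then show ?thesis
    using Tsub T_mem main' unfolding T_def by blast
qed

lemma sets_P: "\<tau> \<in> J \<Longrightarrow> sets (P \<tau>) = sets borel"
  by (simp add: P_density sets_nu)

lemma second_moment_P:
  assumes "\<tau> \<in> J"
  shows "(\<integral>y. y\<^sup>2 \<partial>P \<tau>) = deriv (deriv b) \<tau> + (deriv b \<tau>)\<^sup>2"
proof -
  interpret prob_space "P \<tau>" by (rule P_prob[OF assms])
  have "(\<integral>y. (y - deriv b \<tau>)\<^sup>2 \<partial>P \<tau>) = (\<integral>y. y\<^sup>2 - 2 * deriv b \<tau> * y + (deriv b \<tau>)\<^sup>2 \<partial>P \<tau>)"
    by (simp add: power2_diff algebra_simps)
  also have "\<dots> = (\<integral>y. y\<^sup>2 \<partial>P \<tau>) - 2 * deriv b \<tau> * deriv b \<tau> + (deriv b \<tau>)\<^sup>2"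
    using P_moments[OF assms] P_mean[OF assms] by (simp add: prob_space)
  finally show ?thesis
    using P_variance[OF assms] by (simp add: power2_eq_square)
qed

lemma second_moment_P_bounded:
  assumes "{s..t} \<subseteq> J"
  shows "\<exists>C. \<forall>\<tau>\<in>{s..t}. (\<integral>y. y\<^sup>2 \<partial>P \<tau>) \<le> C"
proof -
  have "continuous_on {s..t} (\<lambda>\<tau>. deriv (deriv b) \<tau> + (deriv b \<tau>)\<^sup>2)"
    by (intro continuous_intros continuous_on_subset[OF continuous_on_deriv2_b assms]
        continuous_on_subset[OF continuous_on_deriv_b assms])
  then have "bounded ((\<lambda>\<tau>. deriv (deriv b) \<tau> + (deriv b \<tau>)\<^sup>2) ` {s..t})"
    by (intro compact_imp_bounded compact_continuous_image) auto
  then obtain C where "\<forall>\<tau>\<in>{s..t}. \<bar>deriv (deriv b) \<tau> + (deriv b \<tau>)\<^sup>2\<bar> \<le> C"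
    by (auto simp: bounded_iff)
  then show ?thesis
    using second_moment_P assms by (metis abs_le_D1 subsetD)
qed

text \<open>In other words, \<open>log K\<close> is almost surely finite under \<open>P \<tau>\<close>.\<close>

lemma P_K_zero:
  assumes "\<tau> \<in> J"
  shows "measure (P \<tau>) {y. K y = 0} = 0"
proof -
  note [measurable] = K_measurable
  have [measurable_cong]: "sets \<nu> = sets borel" by (rule sets_nu)
  have "emeasure (P \<tau>) {y. K y = 0} = (\<integral>\<^sup>+y. ennreal (K y * exp (\<tau> * y - b \<tau>)) * indicator {y. K y = 0} y \<partial>\<nu>)"
    unfolding P_density[OF assms] by (rule emeasure_density) auto
  also have "\<dots> = (\<integral>\<^sup>+y. 0 \<partial>\<nu>)"
    by (rule nn_integral_cong) (auto simp: indicator_def)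
  finally show ?thesis by (simp add: measure_def)
qed

end

section \<open>Laws of large numbers for adaptively sampled responses\<close>

lemma abs_le_one_plus_square: "\<bar>y\<bar> \<le> 1 + y\<^sup>2" for y :: real
  using sum_squares_bound[of 1 "\<bar>y\<bar>"] abs_ge_zero[of y] unfolding power2_abs by simp

text \<open>Responses observed in stages. Stage \<open>k\<close> (counted from \<open>0\<close>) consists of the indices \<open>stg k\<close>, at most
  \<open>N\<close> in number; its design points \<open>X i\<close> are known at time \<open>k\<close> and its responses \<open>Y i\<close> at time \<open>k + 1\<close>.
  Given the past, \<open>Y i\<close> has distribution \<open>P (\<tau> (X i))\<close>, where \<open>\<tau> x\<close> is the true natural parameter at
  \<open>x\<close>; its values stay in the compact interval from \<open>s\<close> to \<open>t\<close>. No joint law of the responses of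
  one stage is prescribed: orthogonality of the stages is all that the laws of large numbers need.\<close>

locale adaptive_responses = prob_space M + exponential_family J P \<nu> K b
  for M :: "'w measure" and J P \<nu> K b +
  fixes F :: "nat \<Rightarrow> 'w measure" and stg :: "nat \<Rightarrow> nat set"
    and S :: "'x::topological_space set" and \<tau> :: "'x \<Rightarrow> real"
    and X :: "nat \<Rightarrow> 'w \<Rightarrow> 'x" and Y :: "nat \<Rightarrow> 'w \<Rightarrow> real" and N :: nat and s t :: real
  assumes sub: "\<And>k. subalgebra M (F k)"
    and mono: "\<And>i j. i \<le> j \<Longrightarrow> sets (F i) \<subseteq> sets (F j)"
    and finite_stg: "\<And>k. finite (stg k)" and card_stg: "\<And>k. card (stg k) \<le> N"
    and X_measurable: "\<And>i k. i \<in> stg k \<Longrightarrow> X i \<in> F k \<rightarrow>\<^sub>M restrict_space borel S"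
    and Y_measurable: "\<And>i k. i \<in> stg k \<Longrightarrow> Y i \<in> borel_measurable (F (Suc k))"
    and cond_distr: "\<And>i k. i \<in> stg k \<Longrightarrow> is_cond_distr M (F k) borel (Y i) (\<lambda>\<omega>. P (\<tau> (X i \<omega>)))"
    and \<tau>_range: "\<And>x. x \<in> S \<Longrightarrow> \<tau> x \<in> {s..t}"
    and st_J: "{s..t} \<subseteq> J"
begin

lemma space_F: "space (F k) = space M"
  using sub[of k] by (simp add: subalgebra_def)

lemma Y_measurable_M: "i \<in> stg k \<Longrightarrow> Y i \<in> borel_measurable M"
  by (rule measurable_from_subalg[OF sub Y_measurable])

lemma X_in_S: "i \<in> stg k \<Longrightarrow> \<omega> \<in> space M \<Longrightarrow> X i \<omega> \<in> S"
  using measurable_space[OF X_measurable, of i k \<omega>] by (simp add: space_F space_restrict_space)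

lemma \<tau>_X: "i \<in> stg k \<Longrightarrow> \<omega> \<in> space M \<Longrightarrow> \<tau> (X i \<omega>) \<in> {s..t}"
  using X_in_S \<tau>_range by blast

lemma \<tau>_X_in_J: "i \<in> stg k \<Longrightarrow> \<omega> \<in> space M \<Longrightarrow> \<tau> (X i \<omega>) \<in> J"
  using \<tau>_X st_J by blast

lemma second_moment_Y:
  obtains C where "0 \<le> C" "\<forall>\<tau>\<in>{s..t}. (\<integral>y. y\<^sup>2 \<partial>P \<tau>) \<le> C"
    "\<forall>k. \<forall>i\<in>stg k. integrable M (\<lambda>\<omega>. (Y i \<omega>)\<^sup>2) \<and> expectation (\<lambda>\<omega>. (Y i \<omega>)\<^sup>2) \<le> C"
proof -
  obtain C0 where "\<forall>\<tau>\<in>{s..t}. (\<integral>y. y\<^sup>2 \<partial>P \<tau>) \<le> C0"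
    using second_moment_P_bounded[OF st_J] by blast
  moreover define C where "C = max C0 0"
  ultimately have C: "\<forall>\<tau>\<in>{s..t}. (\<integral>y. y\<^sup>2 \<partial>P \<tau>) \<le> C" "0 \<le> C" by fastforce+
  have "integrable M (\<lambda>\<omega>. (Y i \<omega>)\<^sup>2) \<and> expectation (\<lambda>\<omega>. (Y i \<omega>)\<^sup>2) \<le> C" if i: "i \<in> stg k" for i k
  proof -
    note [measurable] = Y_measurable_M[OF i]
    have "(\<integral>\<^sup>+\<omega>. ennreal ((Y i \<omega>)\<^sup>2) \<partial>M) = (\<integral>\<^sup>+\<omega>\<in>space M. ennreal ((Y i \<omega>)\<^sup>2) \<partial>M)"
      by (intro nn_integral_cong) auto
    also have "\<dots> = (\<integral>\<^sup>+\<omega>\<in>space M. (\<integral>\<^sup>+y. ennreal (y\<^sup>2) \<partial>P (\<tau> (X i \<omega>))) \<partial>M)"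
      using is_cond_distr_nn_integral[OF prob_space_axioms sub cond_distr[OF i] Y_measurable_M[OF i], of "space M" "\<lambda>y. ennreal (y\<^sup>2)"]
        sets.top[of "F k"] by (simp add: space_F)
    also have "\<dots> \<le> (\<integral>\<^sup>+\<omega>. ennreal (C) \<partial>M)"
    proof (rule nn_integral_mono)
      fix \<omega> assume \<omega>: "\<omega> \<in> space M"
      have "(\<integral>\<^sup>+y. ennreal (y\<^sup>2) \<partial>P (\<tau> (X i \<omega>))) = ennreal (\<integral>y. y\<^sup>2 \<partial>P (\<tau> (X i \<omega>)))"
        using P_moments[OF \<tau>_X_in_J[OF i \<omega>]] by (intro nn_integral_eq_integral) auto
      also have "\<dots> \<le> ennreal (C)"
        using C(1) \<tau>_X[OF i \<omega>] by (intro ennreal_leI) blast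
      finally show "(\<integral>\<^sup>+y. ennreal (y\<^sup>2) \<partial>P (\<tau> (X i \<omega>))) * indicator (space M) \<omega> \<le> ennreal (C)"
        using \<omega> by simp
    qed
    also have "\<dots> = ennreal (C)" by (simp add: emeasure_space_1)
    finally have le: "(\<integral>\<^sup>+\<omega>. ennreal ((Y i \<omega>)\<^sup>2) \<partial>M) \<le> ennreal (C)" .
    then have int: "integrable M (\<lambda>\<omega>. (Y i \<omega>)\<^sup>2)"
      by (intro integrableI_nonneg) (auto simp: le_less_trans[OF _ ennreal_less_top])
    then show ?thesis
      using le nn_integral_eq_integral[OF int] C(2) by simp
  qed
  then show thesis using that[of C] C by simp
qed

text \<open>The stage sums of \<open>u (X i) * (q (Y i) - E (q (Y i) | past))\<close> are martingale differences with
  bounded second moments. The lemma is used for \<open>q y = y\<close> and for \<open>q y = \<bar>y\<bar>\<close>.\<close>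

lemma stagewise_law_of_large_numbers:
  fixes q :: "real \<Rightarrow> real" and u :: "'x \<Rightarrow> real"
  assumes q [measurable]: "q \<in> borel_measurable borel" and q_le: "\<And>y. \<bar>q y\<bar> \<le> \<bar>y\<bar>"
    and u: "u \<in> borel_measurable (restrict_space borel S)" and u_le: "\<And>x. x \<in> S \<Longrightarrow> \<bar>u x\<bar> \<le> U"
  shows "AE \<omega> in M. (\<lambda>m. (\<Sum>k<m. \<Sum>i\<in>stg k.
      u (X i \<omega>) * (q (Y i \<omega>) - (\<integral>y. q y \<partial>P (\<tau> (X i \<omega>))))) / real m) \<longlonglongrightarrow> 0"
proof -
  obtain C where C: "0 \<le> C" "\<forall>\<tau>\<in>{s..t}. (\<integral>y. y\<^sup>2 \<partial>P \<tau>) \<le> C"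
    "\<forall>k. \<forall>i\<in>stg k. integrable M (\<lambda>\<omega>. (Y i \<omega>)\<^sup>2) \<and> expectation (\<lambda>\<omega>. (Y i \<omega>)\<^sup>2) \<le> C"
    by (rule second_moment_Y)
  define R where "R i \<omega> = (\<integral>y. q y \<partial>P (\<tau> (X i \<omega>)))" for i \<omega>
  define d where "d i \<omega> = u (X i \<omega>) * (q (Y i \<omega>) - R i \<omega>)" for i \<omega>
  have int_q: "integrable (P \<sigma>) q" if "\<sigma> \<in> J" for \<sigma>
  proof (rule Bochner_Integration.integrable_bound)
    show "integrable (P \<sigma>) (\<lambda>y. y)" using P_moments[OF that] by simp
    show "q \<in> borel_measurable (P \<sigma>)" using q by (simp add: measurable_cong_sets[OF sets_P[OF that] refl])
  qed (use q_le in simp)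
  have R_le: "\<bar>R i \<omega>\<bar> \<le> 1 + C" if i: "i \<in> stg k" and \<omega>: "\<omega> \<in> space M" for i k \<omega>
  proof -
    note J = \<tau>_X_in_J[OF i \<omega>]
    interpret P: prob_space "P (\<tau> (X i \<omega>))" by (rule P_prob[OF J])
    have le: "\<bar>q y\<bar> \<le> 1 + y\<^sup>2" for y
      by (rule order_trans[OF q_le abs_le_one_plus_square])
    have "\<bar>R i \<omega>\<bar> \<le> (\<integral>y. \<bar>q y\<bar> \<partial>P (\<tau> (X i \<omega>)))"
      unfolding R_def by (rule integral_abs_bound)
    also have "\<dots> \<le> (\<integral>y. 1 + y\<^sup>2 \<partial>P (\<tau> (X i \<omega>)))"
      using int_q[OF J] P_moments[OF J] le by (intro integral_mono) auto
    also have "\<dots> = 1 + (\<integral>y. y\<^sup>2 \<partial>P (\<tau> (X i \<omega>)))"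
      using P_moments[OF J] by (simp add: P.prob_space)
    also have "\<dots> \<le> 1 + C" using C(2) \<tau>_X[OF i \<omega>] by simp
    finally show ?thesis .
  qed
  have u_F: "(\<lambda>\<omega>. u (X i \<omega>)) \<in> borel_measurable (F k)" if "i \<in> stg k" for i k
    by (rule measurable_compose[OF X_measurable[OF that] u])
  have R_F: "R i \<in> borel_measurable (F k)" if "i \<in> stg k" for i k
  proof -
    have "(\<lambda>\<omega>. P (\<tau> (X i \<omega>))) \<in> F k \<rightarrow>\<^sub>M subprob_algebra borel"
      using cond_distr[OF that] by (auto simp: is_cond_distr_def intro: measurable_prob_algebraD)
    then show ?thesis
      unfolding R_def by (rule measurable_compose[OF _ integral_measurable_subprob_algebra[OF q]])
  qed
  have d_F: "d i \<in> borel_measurable (F (Suc k))" if i: "i \<in> stg k" for i k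
  proof -
    have "subalgebra (F (Suc k)) (F k)"
      using mono[of k "Suc k"] by (simp add: subalgebra_def space_F)
    note [measurable] = measurable_from_subalg[OF this u_F[OF i]] measurable_from_subalg[OF this R_F[OF i]]
      Y_measurable[OF i]
    show ?thesis unfolding d_def by measurable
  qed
  have d_M: "d i \<in> borel_measurable M" if "i \<in> stg k" for i k
    by (rule measurable_from_subalg[OF sub d_F[OF that]])
  define V where "V = U\<^sup>2 * (2 * C + 2 * (1 + C)\<^sup>2)"
  have d_le: "(d i \<omega>)\<^sup>2 \<le> U\<^sup>2 * (2 * (Y i \<omega>)\<^sup>2 + 2 * (1 + C)\<^sup>2)" if i: "i \<in> stg k" and \<omega>: "\<omega> \<in> space M" for i k \<omega>
  proof -
    have "(u (X i \<omega>))\<^sup>2 \<le> U\<^sup>2"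
      using u_le[OF X_in_S[OF i \<omega>]] by (rule abs_le_square_iff[THEN iffD1, OF order_trans]) simp
    moreover have "(q (Y i \<omega>))\<^sup>2 \<le> (Y i \<omega>)\<^sup>2" using q_le by (simp only: abs_le_square_iff)
    moreover have "(R i \<omega>)\<^sup>2 \<le> (1 + C)\<^sup>2"
      using R_le[OF i \<omega>] by (rule abs_le_square_iff[THEN iffD1, OF order_trans]) simp
    moreover have "(q (Y i \<omega>) - R i \<omega>)\<^sup>2 \<le> 2 * (q (Y i \<omega>))\<^sup>2 + 2 * (R i \<omega>)\<^sup>2"
      using zero_le_power2[of "q (Y i \<omega>) + R i \<omega>"] by (simp add: power2_sum power2_diff)
    ultimately show ?thesis
      unfolding d_def power_mult_distrib by (intro mult_mono) auto
  qed
  have d_int2: "integrable M (\<lambda>\<omega>. (d i \<omega>)\<^sup>2) \<and> expectation (\<lambda>\<omega>. (d i \<omega>)\<^sup>2) \<le> V" if i: "i \<in> stg k" for i k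
  proof -
    note [measurable] = d_M[OF i]
    have int: "integrable M (\<lambda>\<omega>. U\<^sup>2 * (2 * (Y i \<omega>)\<^sup>2 + 2 * (1 + C)\<^sup>2))"
      using C(3) i by (intro integrable_mult_right Bochner_Integration.integrable_add) auto
    have int2: "integrable M (\<lambda>\<omega>. (d i \<omega>)\<^sup>2)"
      by (rule Bochner_Integration.integrable_bound[OF int]) (use d_le[OF i] in force)+
    have "expectation (\<lambda>\<omega>. (d i \<omega>)\<^sup>2) \<le> expectation (\<lambda>\<omega>. U\<^sup>2 * (2 * (Y i \<omega>)\<^sup>2 + 2 * (1 + C)\<^sup>2))"
      by (rule integral_mono[OF int2 int d_le[OF i]])
    also have "\<dots> = U\<^sup>2 * (2 * expectation (\<lambda>\<omega>. (Y i \<omega>)\<^sup>2) + 2 * (1 + C)\<^sup>2)"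
      using C(3) i by (simp add: prob_space)
    also have "\<dots> \<le> V" unfolding V_def using C(3) i by (intro mult_left_mono add_right_mono) auto
    finally show ?thesis using int2 by simp
  qed
  have V: "0 \<le> V" unfolding V_def using C(1) by simp
  define D where "D k \<omega> = (\<Sum>i\<in>stg k. d i \<omega>)" for k \<omega>
  have D_le: "(D k \<omega>)\<^sup>2 \<le> real N * (\<Sum>i\<in>stg k. (d i \<omega>)\<^sup>2)" for k \<omega>
  proof -
    have "(D k \<omega>)\<^sup>2 \<le> (\<Sum>i\<in>stg k. (d i \<omega>)\<^sup>2) * (\<Sum>i\<in>stg k. 1\<^sup>2)"
      unfolding D_def using sum_squared_le_sum_of_squares[of "\<lambda>i. d i \<omega>" "stg k"] by simp
    also have "\<dots> \<le> (\<Sum>i\<in>stg k. (d i \<omega>)\<^sup>2) * real N"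
      using card_stg[of k] by (intro mult_left_mono sum_nonneg) auto
    finally show ?thesis by (simp add: mult.commute)
  qed
  have D_F: "D k \<in> borel_measurable (F (Suc k))" for k
    unfolding D_def using d_F by (intro borel_measurable_sum)
  have D_int: "integrable M (\<lambda>\<omega>. real N * (\<Sum>i\<in>stg k. (d i \<omega>)\<^sup>2))" for k
    using d_int2 by (intro integrable_mult_right Bochner_Integration.integrable_sum) auto
  have D_int2: "integrable M (\<lambda>\<omega>. (D k \<omega>)\<^sup>2)" for k
    by (rule Bochner_Integration.integrable_bound[OF D_int[of k]])
      (use D_le[of k] measurable_from_subalg[OF sub D_F] in \<open>auto simp: sum_nonneg\<close>)
  have D_bound: "expectation (\<lambda>\<omega>. (D k \<omega>)\<^sup>2) \<le> real N * (real N * V)" for k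
  proof -
    have "expectation (\<lambda>\<omega>. (D k \<omega>)\<^sup>2) \<le> expectation (\<lambda>\<omega>. real N * (\<Sum>i\<in>stg k. (d i \<omega>)\<^sup>2))"
      by (rule integral_mono[OF D_int2 D_int D_le])
    also have "\<dots> = real N * (\<Sum>i\<in>stg k. expectation (\<lambda>\<omega>. (d i \<omega>)\<^sup>2))"
      using d_int2 by (simp add: Bochner_Integration.integral_sum)
    also have "\<dots> \<le> real N * (\<Sum>i\<in>stg k. V)"
      using d_int2 by (intro mult_left_mono sum_mono) auto
    also have "\<dots> \<le> real N * (real N * V)"
      using card_stg[of k] V by (intro mult_left_mono) (auto intro: mult_right_mono)
    finally show ?thesis .
  qed
  have int_of_int2: "integrable M g" if "g \<in> borel_measurable M" "integrable M (\<lambda>\<omega>. (g \<omega>)\<^sup>2)" for g :: "'w \<Rightarrow> real"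
    using integrable_mult_of_squares[of "\<lambda>_. 1" M g] that by simp
  have centred_d: "AE \<omega> in M. real_cond_exp M (F k) (d i) \<omega> = 0" if i: "i \<in> stg k" for i k
  proof -
    interpret F: finite_measure_subalgebra M "F k" by unfold_locales (rule sub)
    note [measurable] = Y_measurable_M[OF i] measurable_from_subalg[OF sub R_F[OF i]]
    have int_qY: "integrable M (\<lambda>\<omega>. q (Y i \<omega>))"
    proof (rule Bochner_Integration.integrable_bound)
      show "integrable M (Y i)" by (rule int_of_int2[OF Y_measurable_M[OF i]]) (use C(3) i in blast)
    qed (use q_le in auto)
    have int_R: "integrable M (R i)"
      by (rule integrable_const_bound[of _ "1 + C"]) (use R_le[OF i] in auto)
    have "AE \<omega> in M. real_cond_exp M (F k) (\<lambda>\<omega>. q (Y i \<omega>)) \<omega> = R i \<omega>"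
      unfolding R_def using \<tau>_X_in_J[OF i] int_q
      by (intro is_cond_distr_real_cond_exp[OF prob_space_axioms sub cond_distr[OF i] Y_measurable_M[OF i] q int_qY]) auto
    moreover have "AE \<omega> in M. real_cond_exp M (F k) (R i) \<omega> = R i \<omega>"
      by (rule F.real_cond_exp_F_meas[OF int_R R_F[OF i]])
    moreover have "AE \<omega> in M. real_cond_exp M (F k) (\<lambda>\<omega>. q (Y i \<omega>) - R i \<omega>) \<omega>
        = real_cond_exp M (F k) (\<lambda>\<omega>. q (Y i \<omega>)) \<omega> - real_cond_exp M (F k) (R i) \<omega>"
      by (rule F.real_cond_exp_diff[OF int_qY int_R])
    moreover have "AE \<omega> in M. real_cond_exp M (F k) (d i) \<omega>
        = u (X i \<omega>) * real_cond_exp M (F k) (\<lambda>\<omega>. q (Y i \<omega>) - R i \<omega>) \<omega>"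
      unfolding d_def[abs_def]
    proof (rule F.real_cond_exp_mult[OF u_F[OF i]])
      show "integrable M (\<lambda>\<omega>. u (X i \<omega>) * (q (Y i \<omega>) - R i \<omega>))"
        using int_of_int2[OF d_M[OF i]] d_int2[OF i] by (simp add: d_def[abs_def])
    qed measurable
    ultimately show ?thesis by eventually_elim simp
  qed
  have centred: "AE \<omega> in M. real_cond_exp M (F k) (D k) \<omega> = 0" for k
  proof -
    interpret F: finite_measure_subalgebra M "F k" by unfold_locales (rule sub)
    \<comment> \<open>Zero outside the stage, so that every summand is integrable.\<close>
    define d' where "d' i \<omega> = (if i \<in> stg k then d i \<omega> else 0)" for i \<omega>
    have "AE \<omega> in M. real_cond_exp M (F k) (\<lambda>\<omega>. \<Sum>i\<in>stg k. d' i \<omega>) \<omega>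
        = (\<Sum>i\<in>stg k. real_cond_exp M (F k) (d' i) \<omega>)"
    proof (rule F.real_cond_exp_sum)
      show "integrable M (d' i)" for i
        using int_of_int2[OF d_M] d_int2 by (cases "i \<in> stg k") (auto simp: d'_def[abs_def])
    qed
    moreover have "(\<lambda>\<omega>. \<Sum>i\<in>stg k. d' i \<omega>) = D k" by (simp add: d'_def D_def fun_eq_iff)
    moreover have "AE \<omega> in M. \<forall>i\<in>stg k. real_cond_exp M (F k) (d' i) \<omega> = 0"
      using centred_d by (intro AE_finite_allI finite_stg) (simp add: d'_def[abs_def])
    ultimately show ?thesis by (auto elim!: eventually_elim2)
  qed
  show ?thesis
    using SLLN_martingale_differences[where F=F and D=D, OF sub mono D_F D_int2 D_bound centred]
    unfolding D_def d_def R_def .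
qed

lemma residual_law_of_large_numbers:
  assumes u: "u \<in> borel_measurable (restrict_space borel S)" and u_le: "\<And>x. x \<in> S \<Longrightarrow> \<bar>u x\<bar> \<le> U"
  shows "AE \<omega> in M. (\<lambda>m. (\<Sum>k<m. \<Sum>i\<in>stg k.
      u (X i \<omega>) * (Y i \<omega> - deriv b (\<tau> (X i \<omega>)))) / real m) \<longlonglongrightarrow> 0"
proof -
  have "AE \<omega> in M. (\<lambda>m. (\<Sum>k<m. \<Sum>i\<in>stg k.
      u (X i \<omega>) * (Y i \<omega> - (\<integral>y. y \<partial>P (\<tau> (X i \<omega>))))) / real m) \<longlonglongrightarrow> 0"
    by (rule stagewise_law_of_large_numbers[of "\<lambda>y. y", OF _ _ u u_le]) auto
  then show ?thesis
  proof (rule AE_mp, intro AE_I2 impI)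
    fix \<omega> assume \<omega>: "\<omega> \<in> space M"
      and lim: "(\<lambda>m. (\<Sum>k<m. \<Sum>i\<in>stg k. u (X i \<omega>) * (Y i \<omega> - (\<integral>y. y \<partial>P (\<tau> (X i \<omega>))))) / real m) \<longlonglongrightarrow> 0"
    have "(\<Sum>k<m. \<Sum>i\<in>stg k. u (X i \<omega>) * (Y i \<omega> - (\<integral>y. y \<partial>P (\<tau> (X i \<omega>)))))
        = (\<Sum>k<m. \<Sum>i\<in>stg k. u (X i \<omega>) * (Y i \<omega> - deriv b (\<tau> (X i \<omega>))))" for m
      by (intro sum.cong refl) (simp add: P_mean \<tau>_X_in_J[OF _ \<omega>])
    then show "(\<lambda>m. (\<Sum>k<m. \<Sum>i\<in>stg k. u (X i \<omega>) * (Y i \<omega> - deriv b (\<tau> (X i \<omega>)))) / real m) \<longlonglongrightarrow> 0"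
      using lim by simp
  qed
qed

text \<open>The linear growth of the absolute residuals makes the laws of large numbers for single
  parameter points uniform over the parameter space.\<close>

lemma abs_residuals_bounded:
  obtains C where "0 \<le> C"
    "AE \<omega> in M. \<forall>\<^sub>F m in sequentially.
      (\<Sum>k<m. \<Sum>i\<in>stg k. \<bar>Y i \<omega> - deriv b (\<tau> (X i \<omega>))\<bar>) \<le> C * real m"
proof -
  obtain C where C: "0 \<le> C" "\<forall>\<tau>\<in>{s..t}. (\<integral>y. y\<^sup>2 \<partial>P \<tau>) \<le> C"
    by (rule second_moment_Y)
  have abs_mean: "(\<integral>y. \<bar>y\<bar> \<partial>P \<sigma>) \<le> 1 + C" if "\<sigma> \<in> {s..t}" for \<sigma>
  proof -
    have J: "\<sigma> \<in> J" using that st_J by blast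
    interpret P: prob_space "P \<sigma>" by (rule P_prob[OF J])
    have "(\<integral>y. \<bar>y\<bar> \<partial>P \<sigma>) \<le> (\<integral>y. 1 + y\<^sup>2 \<partial>P \<sigma>)"
      using P_moments[OF J] by (intro integral_mono abs_le_one_plus_square) auto
    also have "\<dots> = 1 + (\<integral>y. y\<^sup>2 \<partial>P \<sigma>)"
      using P_moments[OF J] by (simp add: P.prob_space)
    finally show ?thesis using C(2) that by force
  qed
  define E where "E = 2 * (1 + C) * real N + 1"
  have "AE \<omega> in M. (\<lambda>m. (\<Sum>k<m. \<Sum>i\<in>stg k.
      1 * (\<bar>Y i \<omega>\<bar> - (\<integral>y. \<bar>y\<bar> \<partial>P (\<tau> (X i \<omega>))))) / real m) \<longlonglongrightarrow> 0"
    by (rule stagewise_law_of_large_numbers[of "\<lambda>y. \<bar>y\<bar>" "\<lambda>_. 1" 1]) auto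
  then have "AE \<omega> in M. \<forall>\<^sub>F m in sequentially.
      (\<Sum>k<m. \<Sum>i\<in>stg k. \<bar>Y i \<omega> - deriv b (\<tau> (X i \<omega>))\<bar>) \<le> E * real m"
  proof (rule AE_mp, intro AE_I2 impI)
    fix \<omega> assume \<omega>: "\<omega> \<in> space M"
      and lim: "(\<lambda>m. (\<Sum>k<m. \<Sum>i\<in>stg k. 1 * (\<bar>Y i \<omega>\<bar> - (\<integral>y. \<bar>y\<bar> \<partial>P (\<tau> (X i \<omega>))))) / real m) \<longlonglongrightarrow> 0"
    have le: "\<bar>Y i \<omega> - deriv b (\<tau> (X i \<omega>))\<bar>
        \<le> 1 * (\<bar>Y i \<omega>\<bar> - (\<integral>y. \<bar>y\<bar> \<partial>P (\<tau> (X i \<omega>)))) + 2 * (1 + C)" if i: "i \<in> stg k" for i k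
    proof -
      have "\<bar>deriv b (\<tau> (X i \<omega>))\<bar> \<le> (\<integral>y. \<bar>y\<bar> \<partial>P (\<tau> (X i \<omega>)))"
        using integral_abs_bound[of "P (\<tau> (X i \<omega>))" "\<lambda>y. y"] P_mean[OF \<tau>_X_in_J[OF i \<omega>]] by simp
      moreover have "(\<integral>y. \<bar>y\<bar> \<partial>P (\<tau> (X i \<omega>))) \<le> 1 + C"
        by (rule abs_mean[OF \<tau>_X[OF i \<omega>]])
      ultimately show ?thesis
        using abs_triangle_ineq4[of "Y i \<omega>" "deriv b (\<tau> (X i \<omega>))"] unfolding mult_1 by argo
    qed
    have "\<forall>\<^sub>F m in sequentially. (\<Sum>k<m. \<Sum>i\<in>stg k.
        1 * (\<bar>Y i \<omega>\<bar> - (\<integral>y. \<bar>y\<bar> \<partial>P (\<tau> (X i \<omega>))))) / real m < 1"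
      by (rule order_tendstoD(2)[OF lim]) simp
    then show "\<forall>\<^sub>F m in sequentially.
        (\<Sum>k<m. \<Sum>i\<in>stg k. \<bar>Y i \<omega> - deriv b (\<tau> (X i \<omega>))\<bar>) \<le> E * real m"
      using eventually_gt_at_top[of 0]
    proof eventually_elim
      case (elim m)
      have "(\<Sum>k<m. \<Sum>i\<in>stg k. \<bar>Y i \<omega> - deriv b (\<tau> (X i \<omega>))\<bar>)
          \<le> (\<Sum>k<m. \<Sum>i\<in>stg k. 1 * (\<bar>Y i \<omega>\<bar> - (\<integral>y. \<bar>y\<bar> \<partial>P (\<tau> (X i \<omega>)))) + 2 * (1 + C))"
        by (intro sum_mono le)
      also have "\<dots> = (\<Sum>k<m. \<Sum>i\<in>stg k. 1 * (\<bar>Y i \<omega>\<bar> - (\<integral>y. \<bar>y\<bar> \<partial>P (\<tau> (X i \<omega>)))))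
          + (\<Sum>k<m. real (card (stg k)) * (2 * (1 + C)))"
        by (simp only: sum.distrib sum_constant)
      also have "\<dots> \<le> 1 * real m + (\<Sum>k<m. real N * (2 * (1 + C)))"
      proof (rule add_mono)
        show "(\<Sum>k<m. \<Sum>i\<in>stg k. 1 * (\<bar>Y i \<omega>\<bar> - (\<integral>y. \<bar>y\<bar> \<partial>P (\<tau> (X i \<omega>))))) \<le> 1 * real m"
          using elim by (simp only: pos_divide_less_eq of_nat_0_less_iff less_imp_le)
        show "(\<Sum>k<m. real (card (stg k)) * (2 * (1 + C))) \<le> (\<Sum>k<m. real N * (2 * (1 + C)))"
          using card_stg C(1) by (intro sum_mono mult_right_mono) auto
      qed
      also have "\<dots> = E * real m" by (simp add: E_def algebra_simps)
      finally show ?case .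
    qed
  qed
  moreover have "0 \<le> E" using C(1) by (simp add: E_def)
  ultimately show thesis using that by blast
qed

lemma AE_K_nonzero: "AE \<omega> in M. \<forall>k. \<forall>i\<in>stg k. K (Y i \<omega>) \<noteq> 0"
proof -
  have "AE \<omega> in M. K (Y i \<omega>) \<noteq> 0" if i: "i \<in> stg k" for i k
  proof -
    interpret F: finite_measure_subalgebra M "F k" by unfold_locales (rule sub)
    note [measurable] = Y_measurable_M[OF i] K_measurable
    have "(\<integral>\<^sup>+\<omega>. indicator {y. K y = 0} (Y i \<omega>) \<partial>M)
        = (\<integral>\<^sup>+\<omega>\<in>space M. indicator {y. K y = 0} (Y i \<omega>) \<partial>M)"
      by (intro nn_integral_cong) auto
    also have "\<dots> = (\<integral>\<^sup>+\<omega>\<in>space M. (\<integral>\<^sup>+y. indicator {y. K y = 0} y \<partial>P (\<tau> (X i \<omega>))) \<partial>M)"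
      using is_cond_distr_nn_integral[OF prob_space_axioms sub cond_distr[OF i] Y_measurable_M[OF i], of "space M" "indicator {y. K y = 0}"]
        sets.top[of "F k"] by (simp add: space_F)
    also have "\<dots> = (\<integral>\<^sup>+\<omega>. 0 \<partial>M)"
    proof (rule nn_integral_cong)
      fix \<omega> assume \<omega>: "\<omega> \<in> space M"
      note J = \<tau>_X_in_J[OF i \<omega>]
      interpret P: prob_space "P (\<tau> (X i \<omega>))" by (rule P_prob[OF J])
      have "{y. K y = 0} \<in> sets (P (\<tau> (X i \<omega>)))" by (simp add: sets_P[OF J])
      then show "(\<integral>\<^sup>+y. indicator {y. K y = 0} y \<partial>P (\<tau> (X i \<omega>))) * indicator (space M) \<omega> = 0"
        using P_K_zero[OF J] by (simp add: P.emeasure_eq_measure)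
    qed
    finally have "(\<integral>\<^sup>+\<omega>. indicator {y. K y = 0} (Y i \<omega>) \<partial>M) = 0" by simp
    then have "AE \<omega> in M. (indicator {y. K y = 0} (Y i \<omega>) :: ennreal) = 0"
      by (subst (asm) nn_integral_0_iff_AE) auto
    then show ?thesis by eventually_elim (auto simp: indicator_def split: if_splits)
  qed
  then show ?thesis
    by (auto simp: AE_all_countable intro!: AE_finite_allI finite_stg)
qed

end

section \<open>Convergence of maximizers along a path\<close>

text \<open>The pathwise argument. Read \<open>h i \<theta>\<close> as the natural parameter of observation \<open>i\<close> under \<open>\<theta>\<close>, \<open>e i\<close> as
  its residual, and \<open>est m\<close> as an estimator computed after \<open>m\<close> stages. The estimator satisfies the basic inequality
  \<open>\<beta> \<Sum>(h i (est m) - h i \<theta>0)\<^sup>2 \<le> \<Sum>(h i (est m) - h i \<theta>0) * e i\<close>. The left-hand side is at least of order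
  \<open>m * dist (est m) \<theta>0\<^sup>2\<close>, as all stages but the first are informative; the right-hand side is \<open>o(m)\<close> uniformly in the
  parameter, because the law of large numbers on a dense set, the Lipschitz condition and the bound on the
  absolute residuals extend to a compact set through a finite cover.\<close>

lemma argmax_consistency:
  fixes \<Theta> D :: "'a::metric_space set" and h :: "nat \<Rightarrow> 'a \<Rightarrow> real" and e :: "nat \<Rightarrow> real"
    and stg :: "nat \<Rightarrow> nat set" and est :: "nat \<Rightarrow> 'a"
  assumes compact: "compact \<Theta>" and D: "D \<subseteq> \<Theta>" "\<Theta> \<subseteq> closure D"
    and \<theta>0: "\<theta>0 \<in> \<Theta>" and est: "\<And>m. 1 \<le> m \<Longrightarrow> est m \<in> \<Theta>"
    and L: "0 \<le> L" and lipschitz: "\<And>k i \<theta> \<theta>'. i \<in> stg k \<Longrightarrow> \<theta> \<in> \<Theta> \<Longrightarrow> \<theta>' \<in> \<Theta> \<Longrightarrow> \<bar>h i \<theta> - h i \<theta>'\<bar> \<le> L * dist \<theta> \<theta>'"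
    and LLN: "\<And>\<theta>. \<theta> \<in> D \<Longrightarrow> (\<lambda>m. (\<Sum>k<m. \<Sum>i\<in>stg k. (h i \<theta> - h i \<theta>0) * e i) / real m) \<longlonglongrightarrow> 0"
    and C: "0 \<le> C" and abs_e: "\<forall>\<^sub>F m in sequentially. (\<Sum>k<m. \<Sum>i\<in>stg k. \<bar>e i\<bar>) \<le> C * real m"
    and info_pos: "0 < c" and inform: "\<And>k \<theta>. 1 \<le> k \<Longrightarrow> \<theta> \<in> \<Theta> \<Longrightarrow> c * (dist \<theta> \<theta>0)\<^sup>2 \<le> (\<Sum>i\<in>stg k. (h i \<theta> - h i \<theta>0)\<^sup>2)"
    and \<beta>: "0 < \<beta>" and basic: "\<And>m. 1 \<le> m \<Longrightarrow> \<beta> * (\<Sum>k<m. \<Sum>i\<in>stg k. (h i (est m) - h i \<theta>0)\<^sup>2)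
        \<le> (\<Sum>k<m. \<Sum>i\<in>stg k. (h i (est m) - h i \<theta>0) * e i)"
  shows "est \<longlonglongrightarrow> \<theta>0"
proof -
  have bound: "\<forall>\<^sub>F m in sequentially. \<forall>\<theta>\<in>\<Theta>.
      \<bar>\<Sum>k<m. \<Sum>i\<in>stg k. (h i \<theta> - h i \<theta>0) * e i\<bar> \<le> \<eta> * (1 + L * C) * real m" if \<eta>: "0 < \<eta>" for \<eta>
  proof -
    have "\<Theta> \<subseteq> (\<Union>\<theta>'\<in>D. ball \<theta>' \<eta>)"
    proof
      fix \<theta> assume "\<theta> \<in> \<Theta>"
      then have "\<theta> \<in> closure D" using D(2) by blast
      then obtain \<theta>' where "\<theta>' \<in> D" "dist \<theta>' \<theta> < \<eta>"
        using \<eta> closure_approachable by blast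
      then show "\<theta> \<in> (\<Union>\<theta>'\<in>D. ball \<theta>' \<eta>)" by auto
    qed
    then obtain D' where D': "D' \<subseteq> D" "finite D'" and cover: "\<Theta> \<subseteq> (\<Union>\<theta>'\<in>D'. ball \<theta>' \<eta>)"
      using compactE_image[OF compact, of D "\<lambda>\<theta>'. ball \<theta>' \<eta>"] by auto
    have "\<forall>\<^sub>F m in sequentially. \<bar>(\<Sum>k<m. \<Sum>i\<in>stg k. (h i \<theta>' - h i \<theta>0) * e i) / real m\<bar> < \<eta>" if "\<theta>' \<in> D'" for \<theta>'
    proof -
      have "\<theta>' \<in> D" using that D' by blast
      from tendstoD[OF LLN[OF this] \<eta>] show ?thesis by (simp add: dist_real_def)
    qed
    then have "\<forall>\<^sub>F m in sequentially. \<forall>\<theta>'\<in>D'. \<bar>(\<Sum>k<m. \<Sum>i\<in>stg k. (h i \<theta>' - h i \<theta>0) * e i) / real m\<bar> < \<eta>"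
      by (intro eventually_ball_finite D') blast
    then show ?thesis
      using abs_e eventually_gt_at_top[of 0]
    proof (eventually_elim, intro ballI)
      fix m \<theta>
      assume small: "\<forall>\<theta>'\<in>D'. \<bar>(\<Sum>k<m. \<Sum>i\<in>stg k. (h i \<theta>' - h i \<theta>0) * e i) / real m\<bar> < \<eta>"
        and abs: "(\<Sum>k<m. \<Sum>i\<in>stg k. \<bar>e i\<bar>) \<le> C * real m" and m: "0 < m" and \<theta>: "\<theta> \<in> \<Theta>"
      obtain \<theta>' where \<theta>': "\<theta>' \<in> D'" "dist \<theta>' \<theta> < \<eta>" using cover \<theta> by auto
      have \<theta>'_\<Theta>: "\<theta>' \<in> \<Theta>" using \<theta>'(1) D'(1) D(1) by blast
      have split: "(\<Sum>k<m. \<Sum>i\<in>stg k. (h i \<theta> - h i \<theta>0) * e i)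
          = (\<Sum>k<m. \<Sum>i\<in>stg k. (h i \<theta>' - h i \<theta>0) * e i) + (\<Sum>k<m. \<Sum>i\<in>stg k. (h i \<theta> - h i \<theta>') * e i)"
        unfolding sum.distrib[symmetric] by (intro sum.cong refl) (simp add: algebra_simps)
      have "\<bar>\<Sum>k<m. \<Sum>i\<in>stg k. (h i \<theta> - h i \<theta>') * e i\<bar> \<le> (\<Sum>k<m. \<Sum>i\<in>stg k. \<bar>(h i \<theta> - h i \<theta>') * e i\<bar>)"
        by (intro order_trans[OF sum_abs] sum_mono sum_abs)
      also have "\<dots> \<le> (\<Sum>k<m. \<Sum>i\<in>stg k. (L * \<eta>) * \<bar>e i\<bar>)"
      proof (intro sum_mono)
        fix k i assume "i \<in> stg k"
        then have "\<bar>h i \<theta> - h i \<theta>'\<bar> \<le> L * dist \<theta> \<theta>'" by (rule lipschitz[OF _ \<theta> \<theta>'_\<Theta>])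
        also have "\<dots> \<le> L * \<eta>" using \<theta>'(2) L by (intro mult_left_mono) (auto simp: dist_commute)
        finally show "\<bar>(h i \<theta> - h i \<theta>') * e i\<bar> \<le> (L * \<eta>) * \<bar>e i\<bar>"
          unfolding abs_mult by (rule mult_right_mono) simp
      qed
      also have "\<dots> = L * \<eta> * (\<Sum>k<m. \<Sum>i\<in>stg k. \<bar>e i\<bar>)" by (simp only: sum_distrib_left)
      also have "\<dots> \<le> L * \<eta> * (C * real m)" using abs L \<eta> by (intro mult_left_mono) auto
      finally have 1: "\<bar>\<Sum>k<m. \<Sum>i\<in>stg k. (h i \<theta> - h i \<theta>') * e i\<bar> \<le> L * \<eta> * (C * real m)" .
      have "\<bar>\<Sum>k<m. \<Sum>i\<in>stg k. (h i \<theta>' - h i \<theta>0) * e i\<bar> / real m < \<eta>"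
        using bspec[OF small \<theta>'(1)] by simp
      then have 2: "\<bar>\<Sum>k<m. \<Sum>i\<in>stg k. (h i \<theta>' - h i \<theta>0) * e i\<bar> \<le> \<eta> * real m"
        using m by (simp add: pos_divide_less_eq)
      have "\<eta> * (1 + L * C) * real m = \<eta> * real m + L * \<eta> * (C * real m)" by (simp add: algebra_simps)
      then show "\<bar>\<Sum>k<m. \<Sum>i\<in>stg k. (h i \<theta> - h i \<theta>0) * e i\<bar> \<le> \<eta> * (1 + L * C) * real m"
        unfolding split using 1 2 by linarith
    qed
  qed
  show ?thesis
  proof (rule tendstoI)
    fix \<epsilon> :: real assume \<epsilon>: "0 < \<epsilon>"
    define \<eta> where "\<eta> = \<beta> * c * \<epsilon>\<^sup>2 / (4 * (1 + L * C))"
    have LC: "0 < 1 + L * C" using L C by (simp add: add_pos_nonneg)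
    have \<eta>: "0 < \<eta>" unfolding \<eta>_def using \<beta> info_pos \<epsilon> LC by simp
    have \<eta>_eq: "\<eta> * (1 + L * C) = \<beta> * c * \<epsilon>\<^sup>2 / 4" 
    proof -
      have "\<beta> * c * \<epsilon>\<^sup>2 / (4 * w) * w = \<beta> * c * \<epsilon>\<^sup>2 / 4" if "0 < w" for w
        using that by simp
      from this[OF LC] show ?thesis unfolding \<eta>_def .
    qed
    show "\<forall>\<^sub>F m in sequentially. dist (est m) \<theta>0 < \<epsilon>"
      using bound[OF \<eta>] eventually_ge_at_top[of 2]
    proof eventually_elim
      case (elim m)
      let ?r = "dist (est m) \<theta>0"
      have \<Theta>: "est m \<in> \<Theta>" using elim(2) est by simp
      have "real (m - 1) * (c * ?r\<^sup>2) = (\<Sum>k\<in>{1..<m}. c * ?r\<^sup>2)" by simp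
      also have "\<dots> \<le> (\<Sum>k\<in>{1..<m}. \<Sum>i\<in>stg k. (h i (est m) - h i \<theta>0)\<^sup>2)"
        using \<Theta> by (intro sum_mono inform) auto
      also have "\<dots> \<le> (\<Sum>k<m. \<Sum>i\<in>stg k. (h i (est m) - h i \<theta>0)\<^sup>2)"
        by (intro sum_mono2) (auto intro: sum_nonneg)
      finally have "\<beta> * (real (m - 1) * (c * ?r\<^sup>2)) \<le> \<beta> * (\<Sum>k<m. \<Sum>i\<in>stg k. (h i (est m) - h i \<theta>0)\<^sup>2)"
        using \<beta> by (intro mult_left_mono) auto
      also have "\<dots> \<le> (\<Sum>k<m. \<Sum>i\<in>stg k. (h i (est m) - h i \<theta>0) * e i)"
        using elim(2) by (intro basic) simp
      also have "\<dots> \<le> \<eta> * (1 + L * C) * real m"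
        using bspec[OF elim(1) \<Theta>] by linarith
      finally have "\<beta> * (real (m - 1) * (c * ?r\<^sup>2)) \<le> \<beta> * c * \<epsilon>\<^sup>2 / 4 * real m"
        unfolding \<eta>_eq .
      then have "(\<beta> * c) * (real (m - 1) * ?r\<^sup>2) \<le> (\<beta> * c) * (\<epsilon>\<^sup>2 / 4 * real m)"
        by (simp add: algebra_simps)
      then have *: "real (m - 1) * ?r\<^sup>2 \<le> \<epsilon>\<^sup>2 / 4 * real m"
        using \<beta> info_pos by (subst (asm) mult_le_cancel_left_pos) auto
      have "real m \<le> 2 * real (m - 1)" using elim(2) by simp
      then have "\<epsilon>\<^sup>2 / 4 * real m \<le> \<epsilon>\<^sup>2 / 4 * (2 * real (m - 1))" by (intro mult_left_mono) auto
      with * have "real (m - 1) * ?r\<^sup>2 \<le> real (m - 1) * (\<epsilon>\<^sup>2 / 2)" by (simp add: algebra_simps)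
      then have "?r\<^sup>2 \<le> \<epsilon>\<^sup>2 / 2"
        using elim(2) by (subst (asm) mult_le_cancel_left_pos) auto
      also have "\<dots> < \<epsilon>\<^sup>2" using \<epsilon> by simp
      finally show "?r < \<epsilon>" using \<epsilon> by (auto intro: power2_less_imp_less)
    qed
  qed
qed

section \<open>Strong consistency of the maximum likelihood estimator\<close>

lemma stage_Suc_Suc: "stage p n1 (Suc (Suc k)) = {stage_end p n1 (Suc k) + 1..stage_end p n1 (Suc k) + p}"
  by (simp add: stage_def stage_end_def)

lemma card_stage: "card (stage p n1 (Suc k)) \<le> n1 + p"
  by (cases k) (simp_all add: stage_def stage_end_def)

lemma sum_stages: "(\<Sum>i=1..stage_end p n1 m. g i) = (\<Sum>k<m. \<Sum>i\<in>stage p n1 (Suc k). g i)"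
proof (induction m)
  case (Suc m)
  have le: "stage_end p n1 m \<le> stage_end p n1 (Suc m)"
    by (cases m) (simp_all add: stage_end_def)
  then have "{1..stage_end p n1 (Suc m)} = {1..stage_end p n1 m} \<union> stage p n1 (Suc m)"
    by (auto simp: stage_def)
  moreover have "{1..stage_end p n1 m} \<inter> stage p n1 (Suc m) = {}" by (auto simp: stage_def)
  ultimately have "(\<Sum>i=1..stage_end p n1 (Suc m). g i)
      = (\<Sum>i=1..stage_end p n1 m. g i) + (\<Sum>i\<in>stage p n1 (Suc m). g i)"
    by (simp add: sum.union_disjoint stage_def)
  then show ?case using Suc by simp
qed (simp add: stage_end_def)

text \<open>Where \<open>K\<close> does not vanish, the common summands \<open>log K(y\<^sub>i)\<close> are finite and cancel.\<close>

lemma log_lik_le_iff: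
  assumes "\<And>i. i \<in> {1..n} \<Longrightarrow> K (y i) \<noteq> 0"
  shows "log_lik J K b G f n x y \<theta> \<le> log_lik J K b G f n x y \<theta>' \<longleftrightarrow>
    (\<Sum>i=1..n. glm_tau J b G f (x i) \<theta> * y i - b (glm_tau J b G f (x i) \<theta>))
    \<le> (\<Sum>i=1..n. glm_tau J b G f (x i) \<theta>' * y i - b (glm_tau J b G f (x i) \<theta>'))"
proof -
  have "log_lik J K b G f n x y \<theta> = ereal ((\<Sum>i=1..n. ln (K (y i)))
      + (\<Sum>i=1..n. glm_tau J b G f (x i) \<theta> * y i - b (glm_tau J b G f (x i) \<theta>)))" for \<theta>
    unfolding log_lik_def sum.distrib[symmetric] sum_ereal[symmetric]
    using assms by (intro sum.cong refl) (simp add: ext_ln_def)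
  then show ?thesis by simp
qed

theorem theorem6p1:
  fixes \<X> :: "'x::metric_space set"
    and \<Theta> :: "(real ^ 'p) set"
    and \<mu> :: "'x \<Rightarrow> real ^ 'p \<Rightarrow> real"
    and f\<theta> :: "real ^ 'p \<Rightarrow> 'x \<Rightarrow> real ^ 'p"
    and J :: "real set" and P :: "real \<Rightarrow> real measure" and \<nu> :: "real measure"
    and K b :: "real \<Rightarrow> real"
    and I :: "real set" and G :: "real \<Rightarrow> real" and f :: "'x \<Rightarrow> real ^ 'p"
    and M :: "'w measure" and \<F> :: "nat \<Rightarrow> 'w measure"
    and X :: "nat \<Rightarrow> 'w \<Rightarrow> 'x" and Y :: "nat \<Rightarrow> 'w \<Rightarrow> real"
    and n1 :: nat and n :: "nat \<Rightarrow> nat"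
    and est ml :: "nat \<Rightarrow> (nat \<Rightarrow> 'x \<times> real) \<Rightarrow> real ^ 'p"
    and \<theta>bar :: "real ^ 'p"
  defines "n \<equiv> stage_end CARD('p) n1"
  \<comment> \<open>setting\<close>
  assumes "compact \<X>" and "compact \<Theta>" and "\<theta>bar \<in> \<Theta>"
    and "continuous_on (\<X> \<times> \<Theta>) (\<lambda>(x, \<theta>). \<mu> x \<theta>)"
    and "continuous_on (\<X> \<times> \<Theta>) (\<lambda>(x, \<theta>). f\<theta> \<theta> x)"
    and "\<And>\<theta>. \<theta> \<in> \<Theta> \<Longrightarrow> span (f\<theta> \<theta> ` \<X>) = UNIV"
    and "exponential_family J P \<nu> K b"
  \<comment> \<open>process, algorithm and estimators\<close>
    and "prob_space M"
    and "\<And>i. 1 \<le> i \<Longrightarrow> X i \<in> M \<rightarrow>\<^sub>M restrict_space borel \<X>"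
    and "\<And>i. 1 \<le> i \<Longrightarrow> Y i \<in> borel_measurable M"
    and "1 \<le> n1"
    and "\<And>k. 1 \<le> k \<Longrightarrow> est k \<in> estimators \<X> \<Theta> (n k)"
    and "\<And>k \<omega>. 1 \<le> k \<Longrightarrow> \<omega> \<in> space M \<Longrightarrow>
      det_maximizing \<X> (f\<theta> (est k (history (n k) X Y \<omega>))) (\<lambda>j. X (n k + j) \<omega>)"
    and "\<And>k. 1 \<le> k \<Longrightarrow> ml k \<in> estimators \<X> \<Theta> (n k)"
    and "\<And>k \<omega> \<theta>. 1 \<le> k \<Longrightarrow> \<omega> \<in> space M \<Longrightarrow> \<theta> \<in> \<Theta> \<Longrightarrow>
      log_lik J K b G f (n k) (\<lambda>i. X i \<omega>) (\<lambda>i. Y i \<omega>) \<theta>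
      \<le> log_lik J K b G f (n k) (\<lambda>i. X i \<omega>) (\<lambda>i. Y i \<omega>) (ml k (history (n k) X Y \<omega>))"
  \<comment> \<open>(GLM*)\<close>
    and "open I" and "is_interval I"
    and "\<And>u. u \<in> I \<Longrightarrow> G differentiable (at u)" and "continuous_on I (deriv G)"
    and "\<And>u. u \<in> I \<Longrightarrow> 0 < deriv G u"
    and "G ` I \<subseteq> deriv b ` J"
    and "continuous_on \<X> f"
    and "\<And>x \<theta>. x \<in> \<X> \<Longrightarrow> \<theta> \<in> \<Theta> \<Longrightarrow> f x \<bullet> \<theta> \<in> I"
    and "\<And>x \<theta>. x \<in> \<X> \<Longrightarrow> \<theta> \<in> \<Theta> \<Longrightarrow> \<mu> x \<theta> = G (f x \<bullet> \<theta>)"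
    and "\<And>x \<theta>. x \<in> \<X> \<Longrightarrow> \<theta> \<in> \<Theta> \<Longrightarrow> f\<theta> \<theta> x = glm_phi J b G (f x \<bullet> \<theta>) *\<^sub>R f x"
    and "continuous_on (\<X> \<times> \<Theta>) (\<lambda>(x, \<theta>). glm_phi J b G (f x \<bullet> \<theta>))"
    and "\<And>x \<theta>. x \<in> \<X> \<Longrightarrow> \<theta> \<in> \<Theta> \<Longrightarrow> 0 < glm_phi J b G (f x \<bullet> \<theta>)"
  \<comment> \<open>(a1)\<close>
    and "filtration (space M) \<F>" and "\<And>k. subalgebra M (\<F> k)"
    and "\<And>k. 1 \<le> k \<Longrightarrow>
      (\<lambda>\<omega>. \<lambda>i\<in>stage CARD('p) n1 k. X i \<omega>)
        \<in> \<F> (k - 1) \<rightarrow>\<^sub>M (\<Pi>\<^sub>M i\<in>stage CARD('p) n1 k. restrict_space borel \<X>)"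
    and "\<And>k. 1 \<le> k \<Longrightarrow>
      (\<lambda>\<omega>. \<lambda>i\<in>stage CARD('p) n1 k. Y i \<omega>)
        \<in> \<F> k \<rightarrow>\<^sub>M (\<Pi>\<^sub>M i\<in>stage CARD('p) n1 k. borel)"
  \<comment> \<open>(a2')\<close>
    and "\<And>k. 1 \<le> k \<Longrightarrow>
      is_cond_distr M (\<F> (k - 1)) (\<Pi>\<^sub>M i\<in>stage CARD('p) n1 k. borel)
        (\<lambda>\<omega>. \<lambda>i\<in>stage CARD('p) n1 k. Y i \<omega>)
        (\<lambda>\<omega>. \<Pi>\<^sub>M i\<in>stage CARD('p) n1 k. P (glm_tau J b G f (X i \<omega>) \<theta>bar))"
  shows "AE \<omega> in M. (\<lambda>k. ml k (history (n k) X Y \<omega>)) \<longlonglongrightarrow> \<theta>bar"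
proof -
  note X_comp = \<open>compact \<X>\<close> and \<Theta>_comp = \<open>compact \<Theta>\<close> and \<theta>bar = \<open>\<theta>bar \<in> \<Theta>\<close>
  note X_meas = \<open>\<And>i. 1 \<le> i \<Longrightarrow> X i \<in> M \<rightarrow>\<^sub>M restrict_space borel \<X>\<close>
    and Y_meas = \<open>\<And>i. 1 \<le> i \<Longrightarrow> Y i \<in> borel_measurable M\<close>
    and est = \<open>\<And>k. 1 \<le> k \<Longrightarrow> est k \<in> estimators \<X> \<Theta> (n k)\<close>
    and ml = \<open>\<And>k. 1 \<le> k \<Longrightarrow> ml k \<in> estimators \<X> \<Theta> (n k)\<close>
    and design = \<open>\<And>k \<omega>. 1 \<le> k \<Longrightarrow> \<omega> \<in> space M \<Longrightarrow>
      det_maximizing \<X> (f\<theta> (est k (history (n k) X Y \<omega>))) (\<lambda>j. X (n k + j) \<omega>)\<close>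
    and ml_max = \<open>\<And>k \<omega> \<theta>. 1 \<le> k \<Longrightarrow> \<omega> \<in> space M \<Longrightarrow> \<theta> \<in> \<Theta> \<Longrightarrow>
      log_lik J K b G f (n k) (\<lambda>i. X i \<omega>) (\<lambda>i. Y i \<omega>) \<theta>
      \<le> log_lik J K b G f (n k) (\<lambda>i. X i \<omega>) (\<lambda>i. Y i \<omega>) (ml k (history (n k) X Y \<omega>))\<close>
    and f_cont = \<open>continuous_on \<X> f\<close>
    and fI = \<open>\<And>x \<theta>. x \<in> \<X> \<Longrightarrow> \<theta> \<in> \<Theta> \<Longrightarrow> f x \<bullet> \<theta> \<in> I\<close>
    and sub = \<open>\<And>k. subalgebra M (\<F> k)\<close>
  interpret M: prob_space M by fact
  interpret E: exponential_family J P \<nu> K b by fact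
  interpret filt: filtration "space M" \<F> by fact
  define \<tau> where "\<tau> x \<theta> = glm_tau J b G f x \<theta>" for x \<theta>
  define stg where "stg k = stage CARD('p) n1 (Suc k)" for k

  have stg_pos: "1 \<le> i" if "i \<in> stg k" for i k
    using that by (simp add: stg_def stage_def)
  have X_in: "X i \<omega> \<in> \<X>" if "1 \<le> i" "\<omega> \<in> space M" for i \<omega>
    using measurable_space[OF X_meas[OF that(1)] that(2)] by (simp add: space_restrict_space)
  have estimator_in: "T (history (n k) X Y \<omega>) \<in> \<Theta>"
    if "T \<in> estimators \<X> \<Theta> (n k)" "\<omega> \<in> space M" for k \<omega> and T :: "(nat \<Rightarrow> 'x \<times> real) \<Rightarrow> real ^ 'p"
  proof -
    have "history (n k) X Y \<omega> \<in> space (\<Pi>\<^sub>M i\<in>{1..n k}. restrict_space borel \<X> \<Otimes>\<^sub>M borel)"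
      using X_in that(2) by (auto simp: history_def space_PiM space_pair_measure space_restrict_space)
    then show ?thesis
      using measurable_space[OF that(1)[unfolded estimators_def]] by (simp add: space_restrict_space)
  qed

  \<comment> \<open>All linear predictors lie in a compact subinterval of \<open>I\<close>.\<close>
  obtain u0 u1 where u: "{u0..u1} \<subseteq> I" "u0 \<le> u1" "\<And>x \<theta>. x \<in> \<X> \<Longrightarrow> \<theta> \<in> \<Theta> \<Longrightarrow> f x \<bullet> \<theta> \<in> {u0..u1}"
  proof -
    obtain \<omega> where "\<omega> \<in> space M" using M.not_empty by blast
    then have ne: "\<X> \<times> \<Theta> \<noteq> {}" using X_in[of 1 \<omega>] \<theta>bar by blast
    have cont: "continuous_on (\<X> \<times> \<Theta>) (\<lambda>z. f (fst z) \<bullet> snd z)"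
      by (intro continuous_intros continuous_on_compose2[OF f_cont]) auto
    obtain z0 where z0: "z0 \<in> \<X> \<times> \<Theta>" "\<forall>z\<in>\<X> \<times> \<Theta>. f (fst z0) \<bullet> snd z0 \<le> f (fst z) \<bullet> snd z"
      using continuous_attains_inf[OF compact_Times[OF X_comp \<Theta>_comp] ne cont] by blast
    obtain z1 where z1: "z1 \<in> \<X> \<times> \<Theta>" "\<forall>z\<in>\<X> \<times> \<Theta>. f (fst z) \<bullet> snd z \<le> f (fst z1) \<bullet> snd z1"
      using continuous_attains_sup[OF compact_Times[OF X_comp \<Theta>_comp] ne cont] by blast
    show thesis
    proof (rule that)
      have "f (fst z0) \<bullet> snd z0 \<in> I" "f (fst z1) \<bullet> snd z1 \<in> I"
        using z0(1) z1(1) fI by auto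
      then show "{f (fst z0) \<bullet> snd z0..f (fst z1) \<bullet> snd z1} \<subseteq> I"
        using \<open>is_interval I\<close> unfolding is_interval_1 by (meson atLeastAtMost_iff subsetI)
      show "f (fst z0) \<bullet> snd z0 \<le> f (fst z1) \<bullet> snd z1" using z0(2) z1(1) by blast
      show "f x \<bullet> \<theta> \<in> {f (fst z0) \<bullet> snd z0..f (fst z1) \<bullet> snd z1}" if "x \<in> \<X>" "\<theta> \<in> \<Theta>" for x \<theta>
        using bspec[OF z0(2), of "(x, \<theta>)"] bspec[OF z1(2), of "(x, \<theta>)"] that by simp
    qed
  qed
  have "\<exists>s t. \<exists>c>0. \<exists>c'>0. {s..t} \<subseteq> J \<and> (\<forall>u\<in>{u0..u1}. mean_inv J b (G u) \<in> {s..t}) \<and>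
    (\<forall>u\<in>{u0..u1}. \<forall>v\<in>{u0..u1}.
      c * \<bar>u - v\<bar> \<le> \<bar>mean_inv J b (G u) - mean_inv J b (G v)\<bar> \<and>
      \<bar>mean_inv J b (G u) - mean_inv J b (G v)\<bar> \<le> c' * \<bar>u - v\<bar>)"
    by (rule E.natural_parameter_bilipschitz[OF u(1,2)]) fact+
  then obtain s t c c' where st: "{s..t} \<subseteq> J" and c: "0 < c" "0 < c'"
    and T_range: "\<forall>u\<in>{u0..u1}. mean_inv J b (G u) \<in> {s..t}"
    and T_lip: "\<forall>u\<in>{u0..u1}. \<forall>v\<in>{u0..u1}.
      c * \<bar>u - v\<bar> \<le> \<bar>mean_inv J b (G u) - mean_inv J b (G v)\<bar> \<and>
      \<bar>mean_inv J b (G u) - mean_inv J b (G v)\<bar> \<le> c' * \<bar>u - v\<bar>" by blast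
  have \<tau>_range: "\<tau> x \<theta> \<in> {s..t}" if "x \<in> \<X>" "\<theta> \<in> \<Theta>" for x \<theta>
    unfolding \<tau>_def glm_tau_def using T_range u(3)[OF that] by blast
  have \<tau>_lower: "c * \<bar>f x \<bullet> (\<theta> - \<theta>')\<bar> \<le> \<bar>\<tau> x \<theta> - \<tau> x \<theta>'\<bar>"
    and \<tau>_upper: "\<bar>\<tau> x \<theta> - \<tau> x \<theta>'\<bar> \<le> c' * \<bar>f x \<bullet> (\<theta> - \<theta>')\<bar>"
    if "x \<in> \<X>" "\<theta> \<in> \<Theta>" "\<theta>' \<in> \<Theta>" for x \<theta> \<theta>'
    unfolding \<tau>_def glm_tau_def inner_diff_right
    using T_lip u(3)[OF that(1,2)] u(3)[OF that(1,3)] by blast+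
  have \<tau>_cont: "continuous_on \<X> (\<lambda>x. \<tau> x \<theta>)" if "\<theta> \<in> \<Theta>" for \<theta>
  proof -
    have "c'-lipschitz_on {u0..u1} (\<lambda>u. mean_inv J b (G u))"
      using T_lip c(2) by (intro lipschitz_onI) (auto simp: dist_real_def)
    then have "continuous_on {u0..u1} (\<lambda>u. mean_inv J b (G u))"
      by (rule lipschitz_on_continuous_on)
    moreover have "continuous_on \<X> (\<lambda>x. f x \<bullet> \<theta>)"
      by (intro continuous_intros f_cont)
    moreover have "(\<lambda>x. f x \<bullet> \<theta>) ` \<X> \<subseteq> {u0..u1}"
      using u(3)[OF _ that] by blast
    ultimately show ?thesis
      unfolding \<tau>_def glm_tau_def by (rule continuous_on_compose2)
  qed

  obtain R where R: "0 \<le> R" "\<And>x. x \<in> \<X> \<Longrightarrow> norm (f x) \<le> R"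
  proof -
    have "bounded (f ` \<X>)" using compact_continuous_image[OF f_cont X_comp] by (rule compact_imp_bounded)
    then obtain R where "\<forall>x\<in>\<X>. norm (f x) \<le> R" by (auto simp: bounded_iff)
    then show thesis by (intro that[of "max R 0"]) fastforce+
  qed

  \<comment> \<open>\<open>stage\<close> counts from \<open>1\<close>, \<open>stg\<close> from \<open>0\<close>; this turns \<open>\<F> (k - 1)\<close> into \<open>\<F> k\<close>.\<close>
  have "adaptive_responses M J P \<nu> K b \<F> stg \<X> (\<lambda>x. \<tau> x \<theta>bar) X Y (n1 + CARD('p)) s t"
  proof (unfold_locales)
    show "subalgebra M (\<F> k)" for k by fact
    show "sets (\<F> i) \<subseteq> sets (\<F> j)" if "i \<le> j" for i j by (rule filt.sets_F_mono[OF that])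
    show "finite (stg k)" for k by (simp add: stg_def stage_def)
    show "card (stg k) \<le> n1 + CARD('p)" for k unfolding stg_def by (rule card_stage)
    show "X i \<in> \<F> k \<rightarrow>\<^sub>M restrict_space borel \<X>" if i: "i \<in> stg k" for i k
    proof -
      have "(\<lambda>\<omega>. \<lambda>i\<in>stg k. X i \<omega>) \<in> \<F> k \<rightarrow>\<^sub>M (\<Pi>\<^sub>M i\<in>stg k. restrict_space borel \<X>)"
        using \<open>\<And>k. 1 \<le> k \<Longrightarrow> (\<lambda>\<omega>. \<lambda>i\<in>stage CARD('p) n1 k. X i \<omega>)
          \<in> \<F> (k - 1) \<rightarrow>\<^sub>M (\<Pi>\<^sub>M i\<in>stage CARD('p) n1 k. restrict_space borel \<X>)\<close>[of "Suc k"]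
        by (simp add: stg_def)
      from measurable_compose[OF this measurable_component_singleton[OF i]] show ?thesis using i by simp
    qed
    show "Y i \<in> borel_measurable (\<F> (Suc k))" if i: "i \<in> stg k" for i k
    proof -
      have "(\<lambda>\<omega>. \<lambda>i\<in>stg k. Y i \<omega>) \<in> \<F> (Suc k) \<rightarrow>\<^sub>M (\<Pi>\<^sub>M i\<in>stg k. borel)"
        using \<open>\<And>k. 1 \<le> k \<Longrightarrow> (\<lambda>\<omega>. \<lambda>i\<in>stage CARD('p) n1 k. Y i \<omega>)
          \<in> \<F> k \<rightarrow>\<^sub>M (\<Pi>\<^sub>M i\<in>stage CARD('p) n1 k. borel)\<close>[of "Suc k"]
        by (simp add: stg_def)
      from measurable_compose[OF this measurable_component_singleton[OF i]] show ?thesis using i by simp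
    qed
    show "is_cond_distr M (\<F> k) borel (Y i) (\<lambda>\<omega>. P (\<tau> (X i \<omega>) \<theta>bar))" if i: "i \<in> stg k" for i k
    proof (rule is_cond_distr_component[OF M.prob_space_axioms sub i])
      show "is_cond_distr M (\<F> k) (\<Pi>\<^sub>M i\<in>stg k. borel) (\<lambda>\<omega>. \<lambda>i\<in>stg k. Y i \<omega>)
          (\<lambda>\<omega>. \<Pi>\<^sub>M i\<in>stg k. P (\<tau> (X i \<omega>) \<theta>bar))"
        using \<open>\<And>k. 1 \<le> k \<Longrightarrow> is_cond_distr M (\<F> (k - 1)) (\<Pi>\<^sub>M i\<in>stage CARD('p) n1 k. borel)
          (\<lambda>\<omega>. \<lambda>i\<in>stage CARD('p) n1 k. Y i \<omega>)
          (\<lambda>\<omega>. \<Pi>\<^sub>M i\<in>stage CARD('p) n1 k. P (glm_tau J b G f (X i \<omega>) \<theta>bar))\<close>[of "Suc k"]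
        by (simp add: stg_def \<tau>_def)
      show "Y i \<in> borel_measurable M" if "i \<in> stg k" for i by (rule Y_meas[OF stg_pos[OF that]])
      show "prob_space (P (\<tau> (X i \<omega>) \<theta>bar)) \<and> sets (P (\<tau> (X i \<omega>) \<theta>bar)) = sets borel"
        if "i \<in> stg k" "\<omega> \<in> space M" for i \<omega>
      proof -
        have "\<tau> (X i \<omega>) \<theta>bar \<in> J"
          using \<tau>_range[OF X_in[OF stg_pos[OF that(1)] that(2)] \<theta>bar] st by blast
        then show ?thesis using E.P_prob E.sets_P by simp
      qed
    qed
    show "\<tau> x \<theta>bar \<in> {s..t}" if "x \<in> \<X>" for x by (rule \<tau>_range[OF that \<theta>bar])
    show "{s..t} \<subseteq> J" by (rule st)
  qed
  then interpret A: adaptive_responses M J P \<nu> K b \<F> stg \<X> "\<lambda>x. \<tau> x \<theta>bar" X Y "n1 + CARD('p)" s t .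

  have "\<exists>c>0. \<forall>\<theta>\<in>\<Theta>. \<forall>x v. det_maximizing \<X> (f\<theta> \<theta>) x
      \<longrightarrow> c * (norm v)\<^sup>2 \<le> (\<Sum>j=1..CARD('p). (f (x j) \<bullet> v)\<^sup>2)"
    by (rule det_maximizing_information[where \<psi>="\<lambda>x \<theta>. glm_phi J b G (f x \<bullet> \<theta>)"]) fact+
  then obtain c0 where "0 < c0" and c0: "\<forall>\<theta>\<in>\<Theta>. \<forall>x v. det_maximizing \<X> (f\<theta> \<theta>) x
      \<longrightarrow> c0 * (norm v)\<^sup>2 \<le> (\<Sum>j=1..CARD('p). (f (x j) \<bullet> v)\<^sup>2)" by blast
  obtain \<beta> where "0 < \<beta>" and \<beta>: "\<forall>x\<in>{s..t}. \<forall>y\<in>{s..t}. \<beta> * (y - x)\<^sup>2 \<le> b y - b x - deriv b x * (y - x)"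
    using E.b_strongly_convex[OF st] by blast
  obtain D where D: "countable D" "D \<subseteq> \<Theta>" "\<Theta> \<subseteq> closure D"
    by (rule separable)
  obtain C where C: "0 \<le> C" and abs_res: "AE \<omega> in M. \<forall>\<^sub>F m in sequentially.
      (\<Sum>k<m. \<Sum>i\<in>stg k. \<bar>Y i \<omega> - deriv b (\<tau> (X i \<omega>) \<theta>bar)\<bar>) \<le> C * real m"
    by (rule A.abs_residuals_bounded)
  have LLN: "AE \<omega> in M. \<forall>\<theta>\<in>D. (\<lambda>m. (\<Sum>k<m. \<Sum>i\<in>stg k.
      (\<tau> (X i \<omega>) \<theta> - \<tau> (X i \<omega>) \<theta>bar) * (Y i \<omega> - deriv b (\<tau> (X i \<omega>) \<theta>bar))) / real m) \<longlonglongrightarrow> 0"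
  proof (rule AE_ball_countable'[OF _ D(1)])
    fix \<theta> assume "\<theta> \<in> D"
    then have \<theta>: "\<theta> \<in> \<Theta>" using D(2) by blast
    show "AE \<omega> in M. (\<lambda>m. (\<Sum>k<m. \<Sum>i\<in>stg k.
      (\<tau> (X i \<omega>) \<theta> - \<tau> (X i \<omega>) \<theta>bar) * (Y i \<omega> - deriv b (\<tau> (X i \<omega>) \<theta>bar))) / real m) \<longlonglongrightarrow> 0"
    proof (rule A.residual_law_of_large_numbers[of "\<lambda>x. \<tau> x \<theta> - \<tau> x \<theta>bar"])
      show "(\<lambda>x. \<tau> x \<theta> - \<tau> x \<theta>bar) \<in> borel_measurable (restrict_space borel \<X>)"
        using \<tau>_cont[OF \<theta>] \<tau>_cont[OF \<theta>bar]
        by (intro borel_measurable_continuous_on_restrict continuous_on_diff)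
      show "\<bar>\<tau> x \<theta> - \<tau> x \<theta>bar\<bar> \<le> t - s" if "x \<in> \<X>" for x
        using \<tau>_range[OF that \<theta>] \<tau>_range[OF that \<theta>bar] by auto
    qed
  qed

  show ?thesis
    using A.AE_K_nonzero abs_res LLN AE_space
  proof eventually_elim
    case (elim \<omega>)
    note K_nz = elim(1) and abs_e = elim(2) and lln = elim(3) and \<omega> = elim(4)
    have Xk: "X i \<omega> \<in> \<X>" if "i \<in> stg k" for i k by (rule X_in[OF stg_pos[OF that] \<omega>])
    show ?case
    proof (rule argmax_consistency[where h="\<lambda>i. \<tau> (X i \<omega>)" and D=D and L="c' * R" and stg=stg
          and e="\<lambda>i. Y i \<omega> - deriv b (\<tau> (X i \<omega>) \<theta>bar)" and c="c\<^sup>2 * c0" and \<beta>=\<beta>,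
          OF \<Theta>_comp D(2,3) \<theta>bar])
      show "ml m (history (n m) X Y \<omega>) \<in> \<Theta>" if "1 \<le> m" for m
        by (rule estimator_in[OF ml[OF that] \<omega>])
      show "0 \<le> c' * R" using c(2) R(1) by simp
      show "\<bar>\<tau> (X i \<omega>) \<theta> - \<tau> (X i \<omega>) \<theta>'\<bar> \<le> c' * R * dist \<theta> \<theta>'"
        if "i \<in> stg k" "\<theta> \<in> \<Theta>" "\<theta>' \<in> \<Theta>" for k i \<theta> \<theta>'
      proof -
        have "\<bar>\<tau> (X i \<omega>) \<theta> - \<tau> (X i \<omega>) \<theta>'\<bar> \<le> c' * \<bar>f (X i \<omega>) \<bullet> (\<theta> - \<theta>')\<bar>"
          by (rule \<tau>_upper[OF Xk[OF that(1)] that(2,3)])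
        also have "\<dots> \<le> c' * (R * dist \<theta> \<theta>')"
        proof (rule mult_left_mono)
          have "\<bar>f (X i \<omega>) \<bullet> (\<theta> - \<theta>')\<bar> \<le> norm (f (X i \<omega>)) * norm (\<theta> - \<theta>')"
            by (rule Cauchy_Schwarz_ineq2)
          also have "\<dots> \<le> R * norm (\<theta> - \<theta>')"
            using R(2)[OF Xk[OF that(1)]] by (rule mult_right_mono) simp
          finally show "\<bar>f (X i \<omega>) \<bullet> (\<theta> - \<theta>')\<bar> \<le> R * dist \<theta> \<theta>'" by (simp add: dist_norm)
        qed (use c(2) in simp)
        finally show ?thesis by (simp add: mult.assoc)
      qed
      show "(\<lambda>m. (\<Sum>k<m. \<Sum>i\<in>stg k. (\<tau> (X i \<omega>) \<theta> - \<tau> (X i \<omega>) \<theta>bar)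
          * (Y i \<omega> - deriv b (\<tau> (X i \<omega>) \<theta>bar))) / real m) \<longlonglongrightarrow> 0" if "\<theta> \<in> D" for \<theta>
        using lln that by blast
      show "\<forall>\<^sub>F m in sequentially. (\<Sum>k<m. \<Sum>i\<in>stg k. \<bar>Y i \<omega> - deriv b (\<tau> (X i \<omega>) \<theta>bar)\<bar>) \<le> C * real m"
        by (rule abs_e)
      show "0 \<le> C" by (rule C)
      show "0 < c\<^sup>2 * c0" using c(1) \<open>0 < c0\<close> by simp
      show "c\<^sup>2 * c0 * (dist \<theta> \<theta>bar)\<^sup>2 \<le> (\<Sum>i\<in>stg k. (\<tau> (X i \<omega>) \<theta> - \<tau> (X i \<omega>) \<theta>bar)\<^sup>2)"
        if "1 \<le> k" "\<theta> \<in> \<Theta>" for k \<theta>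
      proof -
        obtain k' where k': "k = Suc k'" using \<open>1 \<le> k\<close> by (cases k) auto
        have stg_k: "stg k = {n k + 1..n k + CARD('p)}"
          unfolding stg_def n_def k' by (rule stage_Suc_Suc)
        have "c0 * (norm (\<theta> - \<theta>bar))\<^sup>2 \<le> (\<Sum>j=1..CARD('p). (f (X (n k + j) \<omega>) \<bullet> (\<theta> - \<theta>bar))\<^sup>2)"
          using c0 estimator_in[OF est[OF \<open>1 \<le> k\<close>] \<omega>] design[OF \<open>1 \<le> k\<close> \<omega>] by blast
        also have "\<dots> = (\<Sum>i\<in>stg k. (f (X i \<omega>) \<bullet> (\<theta> - \<theta>bar))\<^sup>2)"
          unfolding stg_k by (rule sum.reindex_bij_witness[of _ "\<lambda>i. i - n k" "\<lambda>j. n k + j"]) auto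
        finally have "c\<^sup>2 * (c0 * (norm (\<theta> - \<theta>bar))\<^sup>2) \<le> c\<^sup>2 * (\<Sum>i\<in>stg k. (f (X i \<omega>) \<bullet> (\<theta> - \<theta>bar))\<^sup>2)"
          by (rule mult_left_mono) simp
        also have "\<dots> = (\<Sum>i\<in>stg k. (c * \<bar>f (X i \<omega>) \<bullet> (\<theta> - \<theta>bar)\<bar>)\<^sup>2)"
          by (simp add: sum_distrib_left power_mult_distrib)
        also have "\<dots> \<le> (\<Sum>i\<in>stg k. (\<tau> (X i \<omega>) \<theta> - \<tau> (X i \<omega>) \<theta>bar)\<^sup>2)"
        proof (rule sum_mono)
          fix i assume i: "i \<in> stg k"
          have "(c * \<bar>f (X i \<omega>) \<bullet> (\<theta> - \<theta>bar)\<bar>)\<^sup>2 \<le> \<bar>\<tau> (X i \<omega>) \<theta> - \<tau> (X i \<omega>) \<theta>bar\<bar>\<^sup>2"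
            using \<tau>_lower[OF Xk[OF i] \<open>\<theta> \<in> \<Theta>\<close> \<theta>bar] c(1) by (intro power_mono) auto
          then show "(c * \<bar>f (X i \<omega>) \<bullet> (\<theta> - \<theta>bar)\<bar>)\<^sup>2 \<le> (\<tau> (X i \<omega>) \<theta> - \<tau> (X i \<omega>) \<theta>bar)\<^sup>2"
            by simp
        qed
        finally show ?thesis by (simp add: dist_norm mult.assoc)
      qed
      show "0 < \<beta>" by fact
      show "\<beta> * (\<Sum>k<m. \<Sum>i\<in>stg k. (\<tau> (X i \<omega>) (ml m (history (n m) X Y \<omega>)) - \<tau> (X i \<omega>) \<theta>bar)\<^sup>2)
          \<le> (\<Sum>k<m. \<Sum>i\<in>stg k. (\<tau> (X i \<omega>) (ml m (history (n m) X Y \<omega>)) - \<tau> (X i \<omega>) \<theta>bar)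
            * (Y i \<omega> - deriv b (\<tau> (X i \<omega>) \<theta>bar)))" if m: "1 \<le> m" for m
      proof -
        define \<theta>m where "\<theta>m = ml m (history (n m) X Y \<omega>)"
        have \<theta>m: "\<theta>m \<in> \<Theta>" unfolding \<theta>m_def by (rule estimator_in[OF ml[OF m] \<omega>])
        have sums: "(\<Sum>k<m. \<Sum>i\<in>stg k. g i) = (\<Sum>i=1..n m. g i)" for g :: "nat \<Rightarrow> real"
          unfolding stg_def n_def by (rule sum_stages[symmetric])
        \<comment> \<open>The stages exhaust the indices up to \<open>n m\<close>, so \<open>K (Y i \<omega>)\<close> vanishes for none of them;
          this is read off from the reindexed sum of indicators.\<close>
        have "(\<Sum>k<m. \<Sum>i\<in>stg k. if K (Y i \<omega>) = 0 then 1 else 0 :: real) = 0"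
          using K_nz by simp
        then have "(\<Sum>i=1..n m. if K (Y i \<omega>) = 0 then 1 else 0 :: real) = 0"
          unfolding sums .
        then have K_nz': "K (Y i \<omega>) \<noteq> 0" if "i \<in> {1..n m}" for i
          using that by (subst (asm) sum_nonneg_eq_0_iff) (auto split: if_splits)
        have "(\<Sum>i=1..n m. \<tau> (X i \<omega>) \<theta>bar * Y i \<omega> - b (\<tau> (X i \<omega>) \<theta>bar))
            \<le> (\<Sum>i=1..n m. \<tau> (X i \<omega>) \<theta>m * Y i \<omega> - b (\<tau> (X i \<omega>) \<theta>m))"
          unfolding \<tau>_def \<theta>m_def
          by (rule log_lik_le_iff[of "n m" K "\<lambda>i. Y i \<omega>", THEN iffD1, OF K_nz' ml_max[OF m \<omega> \<theta>bar]])
        \<comment> \<open>Strong convexity of \<open>b\<close> bounds the deterministic part of the log-likelihood ratio.\<close>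
        moreover have "\<beta> * (\<Sum>i=1..n m. (\<tau> (X i \<omega>) \<theta>m - \<tau> (X i \<omega>) \<theta>bar)\<^sup>2)
            \<le> (\<Sum>i=1..n m. b (\<tau> (X i \<omega>) \<theta>m) - b (\<tau> (X i \<omega>) \<theta>bar)
              - deriv b (\<tau> (X i \<omega>) \<theta>bar) * (\<tau> (X i \<omega>) \<theta>m - \<tau> (X i \<omega>) \<theta>bar))"
          unfolding sum_distrib_left
        proof (rule sum_mono)
          fix i assume "i \<in> {1..n m}"
          then have x: "X i \<omega> \<in> \<X>" using X_in \<omega> by simp
          show "\<beta> * (\<tau> (X i \<omega>) \<theta>m - \<tau> (X i \<omega>) \<theta>bar)\<^sup>2
            \<le> b (\<tau> (X i \<omega>) \<theta>m) - b (\<tau> (X i \<omega>) \<theta>bar)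
              - deriv b (\<tau> (X i \<omega>) \<theta>bar) * (\<tau> (X i \<omega>) \<theta>m - \<tau> (X i \<omega>) \<theta>bar)"
            using \<beta> \<tau>_range[OF x \<theta>m] \<tau>_range[OF x \<theta>bar] by blast
        qed
        moreover have "(\<Sum>i=1..n m. (\<tau> (X i \<omega>) \<theta>m - \<tau> (X i \<omega>) \<theta>bar) * (Y i \<omega> - deriv b (\<tau> (X i \<omega>) \<theta>bar)))
          = (\<Sum>i=1..n m. \<tau> (X i \<omega>) \<theta>m * Y i \<omega> - b (\<tau> (X i \<omega>) \<theta>m))
            - (\<Sum>i=1..n m. \<tau> (X i \<omega>) \<theta>bar * Y i \<omega> - b (\<tau> (X i \<omega>) \<theta>bar))
            + (\<Sum>i=1..n m. b (\<tau> (X i \<omega>) \<theta>m) - b (\<tau> (X i \<omega>) \<theta>bar)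
              - deriv b (\<tau> (X i \<omega>) \<theta>bar) * (\<tau> (X i \<omega>) \<theta>m - \<tau> (X i \<omega>) \<theta>bar))"
          unfolding sum_subtractf[symmetric] sum.distrib[symmetric]
          by (intro sum.cong refl) (simp add: algebra_simps)
        ultimately show ?thesis
          unfolding sums \<theta>m_def[symmetric] by linarith
      qed
    qed
  qed
qed

end
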